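(* Let $\mathbb{P}_{\Delta}$ be a complete simplicial toric variety of dimension $n$, with homogeneous coordinates $z_1,\ldots,z_{n+r}$. Let $V=\{f=0\}\subset\mathbb{P}_{\Delta}$ be a strongly quasi-smooth hypersurface of degree $\alpha\in\mathcal{A}_{n-1}(\mathbb{P}_{\Delta})$. If $X$ is a quasi-homogeneous vector field that leaves $V$ invariant, then $$X = \sum_{j<k}P_{j,k}^{\,i}\left(\frac{\partial f}{\partial z_{j}}\frac{\partial}{\partial z_{k}}-\frac{\partial f}{\partial z_{k}}\frac{\partial}{\partial z_{j}} \right)+\frac{g}{\theta_i(\alpha)}\sum_{j=1}^{n+r}a_{i,j} z_{j} \frac{\partial }{\partial z_{j}},\qquad i=1,\dots,r,$$ where $P_{j,k}^{\,i},\, g\in \mathbb{C}[z_1,\dots,z_{n+r}]$ are quasi-homogeneous polynomials.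
   Context: Toric setting: $\Delta$ is a complete simplicial fan in $N\simeq\mathbb{Z}^n$ with rays $\rho_1,\dots,\rho_{n+r}$, where $n_{\rho_j}$ is the generator of $\rho_j\cap N$; $M=\mathrm{Hom}(N,\mathbb{Z})$; $D_j$ is the torus-invariant Weil divisor corresponding to $\rho_j$. The Weil divisor class group $\mathcal{A}_{n-1}(\mathbb{P}_{\Delta})=\mathbb{Z}^{n+r}/\{(\langle m,n_{\rho_j}\rangle)_j: m\in M\}$ is a finitely generated abelian group of rank $r$. The homogeneous coordinate ring $\mathrm{S}=\mathbb{C}[z_1,\dots,z_{n+r}]$ is graded by $\mathcal{A}_{n-1}(\mathbb{P}_{\Delta})$ with $\deg(z_j)=[D_j]$; $\mathrm{S}_\alpha$ is the graded piece of degree $\alpha$, and its elements are called quasi-homogeneous of degree $\alpha$. $\mathbb{P}_{\Delta}$ is the geometric quotient $(\mathbb{C}^{n+r}\setminus\mathcal{Z})/G$, with $G=\mathrm{Hom}_{\mathbb{Z}}(\mathcal{A}_{n-1}(\mathbb{P}_{\Delta}),\mathbb{C}^* )$ acting by $g\cdot(t_j)=(g([D_j])t_j)$ and $\mathcal{Z}$ the common zero set of the monomials $\prod_{\rho_j\notin\sigma(1)}z_j$, $\sigma\in\Delta$, where $\sigma(1)$ is the set of rays of $\sigma$. The numbers $a_{i,j}$ come from $r$ relations, linearly independent over $\mathbb{Z}$, among the $n_{\rho_j}$: $\sum_{j=1}^{n+r}a_{i,j}n_{\rho_j}=0$, $i=1,\dots,r$. For each class $\alpha$ and each $i$, $\theta_i(\alpha)$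 is the complex number such that $\sum_{j=1}^{n+r}a_{i,j}z_j\frac{\partial f}{\partial z_j}=\theta_i(\alpha)\cdot f$ for every $f\in\mathrm{S}_\alpha$ (Euler formula). A quasi-homogeneous vector field of degree $\delta\in\mathcal{A}_{n-1}(\mathbb{P}_{\Delta})$ is a polynomial vector field $X=\sum_{j=1}^{n+r}P_j\frac{\partial}{\partial z_j}$ with $P_j$ quasi-homogeneous of degree $\delta+\deg(z_j)$. For a quasi-homogeneous polynomial $f$ of degree $\alpha$, the hypersurface $V=\{f=0\}\subset\mathbb{P}_{\Delta}$ has degree $\alpha$; it is strongly quasi-smooth if its tangent cone $\{f=0\}$ on $\mathbb{C}^{n+r}\setminus\{0\}$ is smooth. $X$ leaves $V$ invariant if $X(f)=g\cdot f$ for some quasi-homogeneous polynomial $g$.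
   Formalization: The formula is asserted only for those i with θ_i(α) ≠ 0; when θ_i(α) = 0 (e.g. f = z_1 on P^1×P^1 with the relation of the second factor) the quotient g/θ_i(α) is undefined. *)

theory Defs
  imports "HOL-Analysis.Analysis" "HOL-Algebra.Coset" "HOL-Library.Poly_Mapping"
begin

text \<open>
  The lattice \<open>N\<close> is \<^typ>\<open>int ^ 'n\<close>, inside \<^typ>\<open>real ^ 'n\<close>, so that \<open>n = CARD('n)\<close>.
  The rays, the invariant divisors \<open>D\<^sub>j\<close> and the homogeneous coordinates \<open>z\<^sub>j\<close> are indexed by
  a finite linearly ordered type \<open>'k\<close> with \<open>CARD('k) = n + r\<close>.
\<close>

section \<open>Complete simplicial fans\<close>

definition lattice_vec :: "int ^ 'n \<Rightarrow> real ^ 'n" where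
  "lattice_vec v = (\<chi> i. real_of_int (v $ i))"

definition rational_polyhedral_cone :: "(real ^ 'n) set \<Rightarrow> bool" where
  "rational_polyhedral_cone \<sigma> \<longleftrightarrow>
     (\<exists>B :: (int ^ 'n) set. finite B \<and> \<sigma> = convex_cone hull (lattice_vec ` B))"

definition strongly_convex_cone :: "(real ^ 'n) set \<Rightarrow> bool" where
  "strongly_convex_cone \<sigma> \<longleftrightarrow> \<sigma> \<inter> uminus ` \<sigma> = {0}"

text \<open>The empty set is a face in the sense of \<^const>\<open>face_of\<close>, but not a face of a cone.\<close>

definition fan :: "(real ^ 'n) set set \<Rightarrow> bool" where
  "fan \<Delta> \<longleftrightarrow>
     finite \<Delta> \<and>
     (\<forall>\<sigma>\<in>\<Delta>. rational_polyhedral_cone \<sigma> \<and> strongly_convex_cone \<sigma>) \<and>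
     (\<forall>\<sigma>\<in>\<Delta>. \<forall>\<tau>. \<tau> face_of \<sigma> \<and> \<tau> \<noteq> {} \<longrightarrow> \<tau> \<in> \<Delta>) \<and>
     (\<forall>\<sigma>\<in>\<Delta>. \<forall>\<tau>\<in>\<Delta>. (\<sigma> \<inter> \<tau>) face_of \<sigma> \<and> (\<sigma> \<inter> \<tau>) face_of \<tau>)"

definition complete_fan :: "(real ^ 'n) set set \<Rightarrow> bool" where
  "complete_fan \<Delta> \<longleftrightarrow> fan \<Delta> \<and> \<Union>\<Delta> = UNIV"

definition simplicial_fan :: "(real ^ 'n) set set \<Rightarrow> bool" where
  "simplicial_fan \<Delta> \<longleftrightarrow>
     fan \<Delta> \<and> (\<forall>\<sigma>\<in>\<Delta>. \<exists>B. independent B \<and> \<sigma> = convex_cone hull B)"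

definition rays :: "(real ^ 'n) set set \<Rightarrow> (real ^ 'n) set set" where
  "rays \<Delta> = {\<rho> \<in> \<Delta>. dim \<rho> = 1}"

text \<open>\<open>v\<close> generates the monoid \<open>\<rho> \<inter> N\<close>.\<close>

definition ray_generator :: "(real ^ 'n) set \<Rightarrow> int ^ 'n \<Rightarrow> bool" where
  "ray_generator \<rho> v \<longleftrightarrow> {w. lattice_vec w \<in> \<rho>} = range (\<lambda>c :: nat. int c *s v)"

section \<open>The divisor class group\<close>

definition divisor_group :: "(int ^ 'k) monoid" where
  "divisor_group = \<lparr>carrier = UNIV, mult = (+), one = 0\<rparr>"

text \<open>The additive maps \<open>m\<close> below are the elements of the dual lattice \<open>M = Hom(N, \<int>)\<close>.\<close>

definition principal_divisors :: "('k::finite \<Rightarrow> int ^ 'n) \<Rightarrow> (int ^ 'k) set" where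
  "principal_divisors u = {(\<chi> j. m (u j)) | m :: int ^ 'n \<Rightarrow> int. Modules.additive m}"

definition class_group :: "('k::finite \<Rightarrow> int ^ 'n) \<Rightarrow> (int ^ 'k) set monoid" where
  "class_group u = divisor_group Mod principal_divisors u"

definition divisor_class :: "('k::finite \<Rightarrow> int ^ 'n) \<Rightarrow> int ^ 'k \<Rightarrow> (int ^ 'k) set" where
  "divisor_class u D = principal_divisors u #>\<^bsub>divisor_group\<^esub> D"

definition deg_var :: "('k::finite \<Rightarrow> int ^ 'n) \<Rightarrow> 'k \<Rightarrow> (int ^ 'k) set" where
  "deg_var u j = divisor_class u (axis j 1)"

section \<open>The homogeneous coordinate ring\<close>

type_synonym 'k cpoly = "('k \<Rightarrow>\<^sub>0 nat) \<Rightarrow>\<^sub>0 complex"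

definition const_poly :: "complex \<Rightarrow> 'k cpoly" where
  "const_poly c = Poly_Mapping.single 0 c"

definition var_poly :: "'k \<Rightarrow> 'k cpoly" where
  "var_poly j = Poly_Mapping.single (Poly_Mapping.single j 1) 1"

text \<open>
  Truncated subtraction of exponents is harmless here: monomials not containing \<open>z\<^sub>j\<close> get
  the coefficient 0.
\<close>

definition pdiff :: "'k \<Rightarrow> 'k cpoly \<Rightarrow> 'k cpoly" where
  "pdiff j p = (\<Sum>m\<in>Poly_Mapping.keys p.
     Poly_Mapping.single (m - Poly_Mapping.single j 1)
       (of_nat (Poly_Mapping.lookup m j) * Poly_Mapping.lookup p m))"

definition poly_eval :: "('k::finite) cpoly \<Rightarrow> complex ^ 'k \<Rightarrow> complex" where
  "poly_eval p z = (\<Sum>m\<in>Poly_Mapping.keys p.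
     Poly_Mapping.lookup p m * (\<Prod>j\<in>UNIV. (z $ j) ^ Poly_Mapping.lookup m j))"

text \<open>The degree of the monomial \<open>z^m\<close> is the class of \<open>\<Sum>\<^sub>j m\<^sub>j D\<^sub>j\<close>.\<close>

definition graded_piece :: "('k::finite \<Rightarrow> int ^ 'n) \<Rightarrow> (int ^ 'k) set \<Rightarrow> 'k cpoly set" where
  "graded_piece u \<alpha> = {p. \<forall>m\<in>Poly_Mapping.keys p.
     divisor_class u (\<chi> j. int (Poly_Mapping.lookup m j)) = \<alpha>}"

definition quasi_homogeneous :: "('k::finite \<Rightarrow> int ^ 'n) \<Rightarrow> 'k cpoly \<Rightarrow> bool" where
  "quasi_homogeneous u p \<longleftrightarrow> (\<exists>\<alpha>\<in>carrier (class_group u). p \<in> graded_piece u \<alpha>)"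

section \<open>Relations among the rays and the Euler formula\<close>

definition independent_relations ::
    "('k::finite \<Rightarrow> int ^ 'n) \<Rightarrow> nat \<Rightarrow> (nat \<Rightarrow> int ^ 'k) \<Rightarrow> bool" where
  "independent_relations u r a \<longleftrightarrow>
     (\<forall>i\<in>{1..r}. (\<Sum>j\<in>UNIV. a i $ j *s u j) = 0) \<and>
     (\<forall>c :: nat \<Rightarrow> int. (\<Sum>i=1..r. c i *s a i) = 0 \<longrightarrow> (\<forall>i\<in>{1..r}. c i = 0))"

text \<open>
  \<open>euler_weight u b \<alpha>\<close> is \<open>\<theta>\<^sub>i(\<alpha>)\<close> for the relation \<open>b = a\<^sub>i\<close>.
  It is determined by the Euler formula as soon as the graded piece of degree \<open>\<alpha>\<close> is nonzero.
\<close>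

definition euler_weight ::
    "('k::finite \<Rightarrow> int ^ 'n) \<Rightarrow> int ^ 'k \<Rightarrow> (int ^ 'k) set \<Rightarrow> complex" where
  "euler_weight u b \<alpha> = (THE t. \<forall>f\<in>graded_piece u \<alpha>.
     (\<Sum>j\<in>UNIV. of_int (b $ j) * var_poly j * pdiff j f) = const_poly t * f)"

section \<open>Vector fields and hypersurfaces\<close>

text \<open>
  A polynomial vector field \<open>\<Sum>\<^sub>j P\<^sub>j \<partial>/\<partial>z\<^sub>j\<close> is the vector of its components \<open>P\<^sub>j\<close>.
\<close>

definition coord_field :: "'k \<Rightarrow> ('k cpoly) ^ ('k::finite)" where
  "coord_field j = axis j 1"

definition apply_field :: "('k cpoly) ^ ('k::finite) \<Rightarrow> 'k cpoly \<Rightarrow> 'k cpoly" where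
  "apply_field X f = (\<Sum>j\<in>UNIV. X $ j * pdiff j f)"

definition quasi_homogeneous_field ::
    "('k::finite \<Rightarrow> int ^ 'n) \<Rightarrow> (int ^ 'k) set \<Rightarrow> ('k cpoly) ^ ('k::finite) \<Rightarrow> bool" where
  "quasi_homogeneous_field u \<delta> X \<longleftrightarrow>
     (\<forall>j. X $ j \<in> graded_piece u (\<delta> \<otimes>\<^bsub>class_group u\<^esub> deg_var u j))"

text \<open>
  Smoothness of the tangent cone \<open>{f = 0}\<close> away from the origin, as the hypersurface defined
  by the equation \<open>f\<close> (so multiple components are not smooth).
\<close>

definition strongly_quasi_smooth :: "('k::finite) cpoly \<Rightarrow> bool" where
  "strongly_quasi_smooth f \<longleftrightarrow>
     (\<forall>z. z \<noteq> 0 \<and> poly_eval f z = 0 \<longrightarrow> (\<exists>j. poly_eval (pdiff j f) z \<noteq> 0))"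

definition leaves_invariant ::
    "('k::finite \<Rightarrow> int ^ 'n) \<Rightarrow> ('k cpoly) ^ ('k::finite) \<Rightarrow> 'k cpoly \<Rightarrow> bool" where
  "leaves_invariant u X f \<longleftrightarrow> (\<exists>g. quasi_homogeneous u g \<and> apply_field X f = g * f)"

end

theory Submission
  imports Defs "HOL-Computational_Algebra.Fundamental_Theorem_Algebra"
begin

text \<open>
  Fix a relation \<open>b = a\<^sub>i\<close> whose weight \<open>\<theta>\<close> on the class \<open>\<alpha>\<close> is nonzero, and let
  \<open>R = (g/\<theta>) \<Sum>\<^sub>j b\<^sub>j z\<^sub>j \<partial>/\<partial>z\<^sub>j\<close>. Like \<open>X\<close>, the field \<open>R\<close> sends
  \<open>f\<close> to \<open>g f\<close>, by the Euler formula (\<open>euler_formula_weight\<close>), so the components of \<open>X - R\<close> form a syzygy of the partial derivatives of \<open>f\<close>. The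
  assertion is that this syzygy is a combination of the trivial ones.

  By the Euler formula again, a point where all partial derivatives vanish is a zero of \<open>f\<close>, hence
  is the origin by strong quasi-smoothness (\<open>common_zeros_of_partials\<close>). So there are as many
  partial derivatives as variables, and they have at most the origin as a common zero; for such
  families the first Koszul homology vanishes (\<open>syzygies_are_koszul\<close>). Two facts give this.

  The Nullstellensatz (\<open>nullstellensatz_coordinate\<close>) puts a power of every variable into the ideal
  of the partial derivatives. It is proved by specialising one variable at a time: the polynomial
  ring has countable dimension over the uncountable field of complex numbers, so the inverses
  of all \<open>z - c\<close> cannot be linearly independent in a quotient.

  Powers of the variables form a regular sequence. If \<open>x\<close> is in the ideal generated by a family
  and is a nonzerodivisor modulo \<open>J\<close>, then vanishing of Koszul homology modulo \<open>J + (x)\<close> in one degree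
  implies vanishing modulo \<open>J\<close> in the degree below (\<open>koszul_exact_step\<close>). Beyond the number of
  variables the Koszul complex is zero, and as many steps as there are variables lead down to
  degree 1 modulo the zero ideal.

  Finally the coefficients are made quasi-homogeneous by keeping only their parts of the right
  degree (\<open>graded_koszul_syzygies\<close>); for this \<open>g\<close> is taken of the degree of \<open>X\<close>, so that
  \<open>R\<close> has that degree too (\<open>cofactor_homogeneous_part\<close>).
\<close>

section \<open>Ideals and Koszul homology\<close>

definition ideal_set :: "'a::comm_ring_1 set \<Rightarrow> bool" where
  "ideal_set J \<longleftrightarrow> 0 \<in> J \<and> (\<forall>x\<in>J. \<forall>y\<in>J. x + y \<in> J) \<and> (\<forall>s. \<forall>x\<in>J. s * x \<in> J)"

lemma ideal_setD:
  assumes "ideal_set J"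
  shows "0 \<in> J" and "x \<in> J \<Longrightarrow> y \<in> J \<Longrightarrow> x + y \<in> J" and "x \<in> J \<Longrightarrow> s * x \<in> J"
    and "x \<in> J \<Longrightarrow> x * s \<in> J" and "x \<in> J \<Longrightarrow> - x \<in> J"
    and "x \<in> J \<Longrightarrow> y \<in> J \<Longrightarrow> x - y \<in> J"
proof -
  show "0 \<in> J" and add: "x \<in> J \<Longrightarrow> y \<in> J \<Longrightarrow> x + y \<in> J" for x y
    using assms by (auto simp: ideal_set_def)
  show mult: "x \<in> J \<Longrightarrow> s * x \<in> J" for x s
    using assms by (auto simp: ideal_set_def)
  show "x \<in> J \<Longrightarrow> x * s \<in> J"
    using mult[of x s] by (simp add: mult.commute)
  show neg: "x \<in> J \<Longrightarrow> - x \<in> J" for x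
    using mult[of x "-1"] by simp
  show "x \<in> J \<Longrightarrow> y \<in> J \<Longrightarrow> x - y \<in> J"
    using add[of x "- y"] neg[of y] by simp
qed

lemma ideal_set_sum:
  assumes "ideal_set J" and "\<And>i. i \<in> A \<Longrightarrow> h i \<in> J"
  shows "sum h A \<in> J"
  using assms(2) by (induction A rule: infinite_finite_induct) (auto simp: ideal_setD[OF assms(1)])

definition ideal_adjoin :: "'a::comm_ring_1 set \<Rightarrow> 'a \<Rightarrow> 'a set" where
  "ideal_adjoin J x = {p + s * x | p s. p \<in> J}"

lemma ideal_set_adjoin:
  assumes "ideal_set J"
  shows "ideal_set (ideal_adjoin J x)"
proof -
  note J = ideal_setD[OF assms]
  have "0 \<in> ideal_adjoin J x"
    unfolding ideal_adjoin_def using J(1) by (auto intro!: exI[of _ 0])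
  moreover have "(p + s * x) + (q + t * x) \<in> ideal_adjoin J x" if "p \<in> J" "q \<in> J" for p q s t
  proof -
    have "(p + s * x) + (q + t * x) = (p + q) + (s + t) * x" by (simp add: algebra_simps)
    then show ?thesis using J(2)[OF that] unfolding ideal_adjoin_def by blast
  qed
  moreover have "t * (p + s * x) \<in> ideal_adjoin J x" if "p \<in> J" for p s t
  proof -
    have "t * (p + s * x) = t * p + (t * s) * x" by (simp add: algebra_simps)
    then show ?thesis using J(3)[OF that] unfolding ideal_adjoin_def by blast
  qed
  ultimately show ?thesis
    unfolding ideal_set_def by (fastforce simp: ideal_adjoin_def)
qed

lemma ideal_adjoin_supset: "J \<subseteq> ideal_adjoin J x"
proof
  fix p assume "p \<in> J"
  then show "p \<in> ideal_adjoin J x"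
    unfolding ideal_adjoin_def by (intro CollectI exI[of _ p] exI[of _ 0]) simp
qed

lemma ideal_adjoin_mem:
  assumes "ideal_set J"
  shows "x \<in> ideal_adjoin J x"
  unfolding ideal_adjoin_def using ideal_setD(1)[OF assms]
  by (intro CollectI exI[of _ 0] exI[of _ 1]) simp

text \<open>
  Chains of the Koszul complex on a family \<open>f\<close> are functions on finite sets of indices: \<open>c A\<close>
  is the coefficient of the exterior monomial \<open>e\<^sub>A\<close>, the wedge of the \<open>e\<^sub>i\<close> with \<open>i \<in> A\<close> in
  increasing order. Inserting or removing \<open>e\<^sub>i\<close> costs one sign for each smaller index in \<open>A\<close>.
  On such chains \<open>contract f\<close> is the Koszul differential \<open>e\<^sub>i \<mapsto> f i\<close>, and \<open>wedge h\<close>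
  is the exterior product with \<open>\<Sum>\<^sub>i h i e\<^sub>i\<close>.
\<close>

definition koszul_sign :: "'k::linorder \<Rightarrow> 'k set \<Rightarrow> 'a::comm_ring_1" where
  "koszul_sign i A = (-1) ^ card {l \<in> A. l < i}"

definition contract :: "('k::{finite,linorder} \<Rightarrow> 'a::comm_ring_1) \<Rightarrow> ('k set \<Rightarrow> 'a) \<Rightarrow> 'k set \<Rightarrow> 'a"
  where "contract f c A = (\<Sum>i\<in>-A. koszul_sign i A * f i * c (insert i A))"

definition wedge :: "('k::{finite,linorder} \<Rightarrow> 'a::comm_ring_1) \<Rightarrow> ('k set \<Rightarrow> 'a) \<Rightarrow> 'k set \<Rightarrow> 'a"
  where "wedge h c A = (\<Sum>i\<in>A. koszul_sign i A * h i * c (A - {i}))"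

lemma koszul_sign_square: "koszul_sign i A * koszul_sign i A = 1"
  by (simp add: koszul_sign_def flip: power_add mult_2)

lemma koszul_sign_insert:
  fixes i j :: "'k::{finite,linorder}"
  assumes "i \<notin> A"
  shows "koszul_sign j (insert i A) = (if i < j then - koszul_sign j A else koszul_sign j A)"
proof -
  have "{l \<in> insert i A. l < j} = (if i < j then insert i {l \<in> A. l < j} else {l \<in> A. l < j})"
    by auto
  then show ?thesis using assms by (simp add: koszul_sign_def)
qed

lemma koszul_sign_anticommute:
  fixes i j :: "'k::{finite,linorder}"
  assumes "i \<notin> A" "j \<notin> A" "i \<noteq> j"
  shows "koszul_sign i A * koszul_sign j (insert i A)
    = - (koszul_sign j A * koszul_sign i (insert j A))"
  using assms by (auto simp: koszul_sign_insert mult.commute)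

text \<open>
  The terms of the double sum that remove \<open>i\<close> then \<open>j\<close> and \<open>j\<close> then \<open>i\<close> cancel. They are paired
  explicitly, so that 2 may be a zero divisor.
\<close>

lemma contract_contract:
  fixes f :: "'k::{finite,linorder} \<Rightarrow> 'a::comm_ring_1"
  shows "contract f (contract f c) A = 0"
proof -
  define T where "T i j = koszul_sign i A * f i *
    (koszul_sign j (insert i A) * f j * c (insert j (insert i A)))" for i j
  have "contract f (contract f c) A = (\<Sum>i\<in>-A. \<Sum>j\<in>-insert i A. T i j)"
    unfolding contract_def T_def by (simp add: sum_distrib_left)
  also have "\<dots> = (\<Sum>(i,j)\<in>(SIGMA i:-A. -insert i A). T i j)"
    by (rule sum.Sigma) auto
  also have "(SIGMA i:-A. -insert i A)
      = {(i,j). i \<notin> A \<and> j \<notin> A \<and> i < j} \<union> {(i,j). i \<notin> A \<and> j \<notin> A \<and> j < i}" by auto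
  also have "(\<Sum>(i,j)\<in>\<dots>. T i j) = (\<Sum>(i,j)\<in>{(i,j). i \<notin> A \<and> j \<notin> A \<and> i < j}. T i j)
      + (\<Sum>(i,j)\<in>{(i,j). i \<notin> A \<and> j \<notin> A \<and> j < i}. T i j)"
    by (rule sum.union_disjoint) auto
  also have "(\<Sum>(i,j)\<in>{(i,j). i \<notin> A \<and> j \<notin> A \<and> j < i}. T i j)
      = (\<Sum>(i,j)\<in>{(i,j). i \<notin> A \<and> j \<notin> A \<and> i < j}. T j i)"
    by (rule sum.reindex_bij_witness[of _ prod.swap prod.swap]) auto
  also have "\<dots> = - (\<Sum>(i,j)\<in>{(i,j). i \<notin> A \<and> j \<notin> A \<and> i < j}. T i j)"
    unfolding sum_negf[symmetric]
  proof (rule sum.cong[OF refl], clarify)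
    fix i j assume "i \<notin> A" "j \<notin> A" "i < j"
    then have *: "koszul_sign i A * koszul_sign j (insert i A)
        = - (koszul_sign j A * koszul_sign i (insert j A) :: 'a)"
      by (intro koszul_sign_anticommute) auto
    have "T j i = (koszul_sign j A * koszul_sign i (insert j A)) * (f i * f j * c (insert j (insert i A)))"
      by (simp add: T_def insert_commute mult_ac)
    also have "\<dots> = - ((koszul_sign i A * koszul_sign j (insert i A)) * (f i * f j * c (insert j (insert i A))))"
      unfolding * by simp
    also have "\<dots> = - T i j" by (simp add: T_def mult_ac)
    finally show "T j i = - T i j" .
  qed
  finally show ?thesis by simp
qed

text \<open>
  The homotopy that makes every element of the ideal \<open>(f)\<close> act as zero on Koszul homology:
  the diagonal terms of the two double sums add up to the right-hand side, and the off-diagonal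
  terms \<open>T i j\<close> occur once with each sign.
\<close>

lemma contract_wedge:
  fixes f h :: "'k::{finite,linorder} \<Rightarrow> 'a::comm_ring_1"
  shows "contract f (wedge h c) A + wedge h (contract f c) A = (\<Sum>i\<in>UNIV. h i * f i) * c A"
proof -
  define T where "T i j = koszul_sign i A * koszul_sign j (insert i A) * f i * h j
    * c (insert i (A - {j}))" for i j
  have "koszul_sign i A * f i * wedge h c (insert i A) = h i * f i * c A + (\<Sum>j\<in>A. T i j)"
    if "i \<notin> A" for i
  proof -
    have "wedge h c (insert i A) = koszul_sign i A * h i * c A
        + (\<Sum>j\<in>A. koszul_sign j (insert i A) * h j * c (insert i (A - {j})))"
    proof -
      have "insert i A - {j} = insert i (A - {j})" if "j \<in> A" for j
        using that \<open>i \<notin> A\<close> by auto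
      then show ?thesis using that by (simp add: wedge_def koszul_sign_insert)
    qed
    moreover have "koszul_sign i A * f i * (koszul_sign i A * h i * c A) = h i * f i * c A"
      using koszul_sign_square[of i A, where 'a='a]
      by (metis (no_types, lifting) mult.commute mult.left_commute mult_1)
    ultimately show ?thesis
      by (simp add: T_def distrib_left sum_distrib_left mult_ac)
  qed
  then have 1: "contract f (wedge h c) A
      = (\<Sum>i\<in>-A. h i * f i * c A) + (\<Sum>i\<in>-A. \<Sum>j\<in>A. T i j)"
    by (simp add: contract_def flip: sum.distrib)
  have "koszul_sign j A * h j * contract f c (A - {j}) = h j * f j * c A - (\<Sum>i\<in>-A. T i j)"
    if "j \<in> A" for j
  proof -
    define B where "B = A - {j}"
    have A: "A = insert j B" "j \<notin> B" using that by (auto simp: B_def)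
    have "- B = insert j (- A)" "j \<notin> - A" using that by (auto simp: B_def)
    then have "contract f c B = koszul_sign j B * f j * c A
        + (\<Sum>i\<in>-A. koszul_sign i B * f i * c (insert i B))"
      by (simp add: contract_def A(1)[symmetric])
    moreover have "koszul_sign j A = (koszul_sign j B :: 'a)"
      using A by (simp add: koszul_sign_insert)
    moreover have "koszul_sign j A * h j * (koszul_sign i B * f i * c (insert i B)) = - T i j"
      if "i \<notin> A" for i
    proof -
      have *: "koszul_sign j B * koszul_sign i (insert j B)
          = - (koszul_sign i B * koszul_sign j (insert i B) :: 'a)"
        using A that by (intro koszul_sign_anticommute) auto
      have **: "koszul_sign i A * koszul_sign j (insert i A) = - (koszul_sign j A * koszul_sign i B :: 'a)"
        using A that
        by (auto simp: koszul_sign_insert mult.commute insert_commute)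
      show ?thesis unfolding T_def ** B_def[symmetric] by (simp add: mult_ac)
    qed
    moreover have "koszul_sign j B * h j * (koszul_sign j B * f j * c A) = h j * f j * c A"
      using koszul_sign_square[of j B, where 'a='a]
      by (metis (no_types, lifting) mult.commute mult.left_commute mult_1)
    ultimately show ?thesis
      by (simp add: B_def[symmetric] distrib_left sum_distrib_left sum_negf)
  qed
  then have 2: "wedge h (contract f c) A
      = (\<Sum>j\<in>A. h j * f j * c A) - (\<Sum>i\<in>-A. \<Sum>j\<in>A. T i j)"
    by (simp add: wedge_def sum_subtractf sum.swap[of _ A])
  have "(\<Sum>i\<in>UNIV. h i * f i * c A) = (\<Sum>i\<in>-A. h i * f i * c A) + (\<Sum>i\<in>A. h i * f i * c A)"
    by (subst sum.union_disjoint[symmetric]) auto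
  then show ?thesis unfolding 1 2 by (simp add: sum_distrib_right)
qed

lemma contract_diff: "contract f (\<lambda>A. b A - c A) A = contract f b A - contract f c A"
  by (simp add: contract_def right_diff_distrib sum_subtractf)

lemma contract_cmult: "contract f (\<lambda>A. x * c A) A = x * contract f c A"
  by (simp add: contract_def sum_distrib_left mult_ac)

lemma contract_mem:
  assumes "ideal_set J" "\<And>A. c A \<in> J"
  shows "contract f c A \<in> J"
  unfolding contract_def using assms by (intro ideal_set_sum) (auto simp: ideal_setD)

lemma wedge_mem:
  assumes "ideal_set J" "\<And>A. c A \<in> J"
  shows "wedge h c A \<in> J"
  unfolding wedge_def using assms by (intro ideal_set_sum) (auto simp: ideal_setD)

text \<open>
  The vanishing of the Koszul homology \<open>H\<^sub>q(f; R/J)\<close>, phrased for chains lifted to \<open>R\<close>, so that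
  no quotient ring has to be formed.
\<close>

definition koszul_exact :: "('k::{finite,linorder} \<Rightarrow> 'a::comm_ring_1) \<Rightarrow> 'a set \<Rightarrow> nat \<Rightarrow> bool" where
  "koszul_exact f J q \<longleftrightarrow>
     (\<forall>c. (\<forall>A. card A \<noteq> q \<longrightarrow> c A = 0) \<and> (\<forall>A. contract f c A \<in> J) \<longrightarrow>
       (\<exists>b. (\<forall>A. card A \<noteq> Suc q \<longrightarrow> b A = 0) \<and> (\<forall>A. c A - contract f b A \<in> J)))"

lemma koszul_exact_top:
  fixes f :: "'k::{finite,linorder} \<Rightarrow> 'a::comm_ring_1"
  assumes "ideal_set J" "CARD('k) < q"
  shows "koszul_exact f J q"
  unfolding koszul_exact_def
proof (intro allI impI)
  fix c :: "'k set \<Rightarrow> 'a"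
  assume c: "(\<forall>A. card A \<noteq> q \<longrightarrow> c A = 0) \<and> (\<forall>A. contract f c A \<in> J)"
  have "card A \<noteq> q" for A :: "'k set"
    using card_mono[of UNIV A] assms(2) by auto
  with c have "c A = 0" for A by blast
  then show "\<exists>b. (\<forall>A. card A \<noteq> Suc q \<longrightarrow> b A = 0) \<and> (\<forall>A. c A - contract f b A \<in> J)"
    using ideal_setD(1)[OF assms(1)] by (intro exI[of _ "\<lambda>_. 0"]) (simp add: contract_def)
qed

text \<open>
  Here \<open>J'\<close> is \<open>J + (x)\<close>, and \<open>x\<close> is a nonzerodivisor modulo \<open>J\<close> lying in the ideal \<open>(f)\<close>. The
  long exact sequence of \<open>0 \<rightarrow> R/J \<rightarrow> R/J \<rightarrow> R/J' \<rightarrow> 0\<close> (the first map being multiplication by \<open>x\<close>)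
  shows that \<open>x\<close> acts injectively on \<open>H\<^sub>q(f; R/J)\<close> once \<open>H\<^sub>q\<^sub>+\<^sub>1(f; R/J')\<close> vanishes; but \<open>x\<close> acts
  as zero. On chains: for a cycle \<open>c\<close>, the chain \<open>wedge h c\<close> is a cycle modulo \<open>J'\<close>,
  because its boundary is \<open>x c\<close> modulo \<open>J\<close>. Writing it as a boundary plus \<open>x e\<close> and
  applying the differential gives \<open>x c = x \<partial>e\<close> modulo \<open>J\<close>, and \<open>x\<close> can be cancelled.
\<close>

lemma koszul_exact_step:
  fixes f h :: "'k::{finite,linorder} \<Rightarrow> 'a::comm_ring_1"
  assumes J: "ideal_set J" and J': "ideal_set J'"
    and le: "J \<subseteq> J'" and x: "x \<in> J'" and J'_J: "\<And>p. p \<in> J' \<Longrightarrow> \<exists>s. p - x * s \<in> J"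
    and regular: "\<And>s. x * s \<in> J \<Longrightarrow> s \<in> J"
    and x_eq: "x = (\<Sum>i\<in>UNIV. h i * f i)"
    and exact: "koszul_exact f J' (Suc q)"
  shows "koszul_exact f J q"
  unfolding koszul_exact_def
proof (intro allI impI)
  fix c :: "'k set \<Rightarrow> 'a"
  assume c: "(\<forall>A. card A \<noteq> q \<longrightarrow> c A = 0) \<and> (\<forall>A. contract f c A \<in> J)"
  have cw: "x * c A - contract f (wedge h c) A \<in> J" for A
  proof -
    have "x * c A - contract f (wedge h c) A = wedge h (contract f c) A"
      using contract_wedge[of f h c A] by (simp add: x_eq algebra_simps)
    then show ?thesis using wedge_mem[OF J] c by metis
  qed
  have "wedge h c A = 0" if "card A \<noteq> Suc q" for A
  proof -
    have "card (A - {i}) \<noteq> q" if "i \<in> A" for i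
      using \<open>card A \<noteq> Suc q\<close> that card_Suc_Diff1[of A i] by auto
    then show ?thesis using c by (simp add: wedge_def)
  qed
  moreover have "contract f (wedge h c) A \<in> J'" for A
  proof -
    have "x * c A - contract f (wedge h c) A \<in> J'" using cw le by blast
    from ideal_setD(6)[OF J' ideal_setD(4)[OF J' x, of "c A"] this] show ?thesis by simp
  qed
  ultimately obtain b where "\<forall>A. wedge h c A - contract f b A \<in> J'"
    using exact unfolding koszul_exact_def by meson
  then have "\<forall>A. \<exists>s. wedge h c A - contract f b A - x * s \<in> J" using J'_J by blast
  then obtain e0 where e0: "\<And>A. wedge h c A - contract f b A - x * e0 A \<in> J" by metis
  \<comment> \<open>The chain \<open>e0\<close> is chosen coefficient by coefficient, so its other degrees are arbitrary.\<close>
  define e where "e A = (if card A = Suc q then e0 A else 0)" for A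
  have "contract f (\<lambda>A. wedge h c A - contract f b A - x * e0 A) A \<in> J" for A
    by (rule contract_mem[OF J e0])
  then have "contract f (wedge h c) A - x * contract f e0 A \<in> J" for A
    by (simp add: contract_diff contract_contract contract_cmult)
  then have "x * c A - contract f (wedge h c) A + (contract f (wedge h c) A - x * contract f e0 A) \<in> J" for A
    using ideal_setD(2)[OF J cw] by blast
  then have "x * (c A - contract f e0 A) \<in> J" for A by (simp add: algebra_simps)
  then have *: "c A - contract f e0 A \<in> J" for A by (rule regular)
  have "c A - contract f e A \<in> J" for A
  proof (cases "card A = q")
    case True
    then have "contract f e A = contract f e0 A"
      by (simp add: contract_def e_def)
    then show ?thesis using * by simp
  next
    case False
    then have "contract f e A = 0"
      by (auto simp: contract_def e_def intro!: sum.neutral)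
    then show ?thesis using c False ideal_setD(1)[OF J] by simp
  qed
  then show "\<exists>b. (\<forall>A. card A \<noteq> Suc q \<longrightarrow> b A = 0) \<and> (\<forall>A. c A - contract f b A \<in> J)"
    by (intro exI[of _ e]) (simp add: e_def)
qed

section \<open>Polynomials and their values\<close>

lemma poly_mapping_sum_single:
  "(\<Sum>m\<in>Poly_Mapping.keys p. Poly_Mapping.single m (Poly_Mapping.lookup p m)) = p"
proof (rule poly_mapping_eqI)
  fix k
  show "Poly_Mapping.lookup (\<Sum>m\<in>Poly_Mapping.keys p. Poly_Mapping.single m (Poly_Mapping.lookup p m)) k
    = Poly_Mapping.lookup p k"
    by (auto simp: lookup_sum lookup_single when_def in_keys_iff)
qed

lemma cpoly_induct [case_names zero single add]:
  fixes p :: "'k cpoly"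
  assumes "P 0" and "\<And>m c. P (Poly_Mapping.single m c)"
    and "\<And>p q. P p \<Longrightarrow> P q \<Longrightarrow> P (p + q)"
  shows "P p"
proof -
  have "P (\<Sum>m\<in>M. Poly_Mapping.single m (Poly_Mapping.lookup p m))" if "finite M" for M
    using that by (induction M) (auto intro: assms)
  then show ?thesis using poly_mapping_sum_single[of p] by (metis finite_keys)
qed

lemma const_poly_simps [simp]:
  "const_poly 0 = 0" "const_poly 1 = 1"
  by (simp_all add: const_poly_def)

lemma const_poly_add: "const_poly (a + b) = const_poly a + const_poly b"
  by (simp add: const_poly_def single_add)

lemma const_poly_uminus: "const_poly (- a) = - const_poly a"
  by (simp add: const_poly_def single_uminus)

lemma const_poly_mult: "const_poly (a * b) = const_poly a * const_poly b"
  by (simp add: const_poly_def mult_single)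

lemma const_poly_prod: "const_poly (prod h A) = (\<Prod>i\<in>A. const_poly (h i))"
  by (induction A rule: infinite_finite_induct) (auto simp: const_poly_mult)

lemma const_poly_power: "const_poly (a ^ n) = const_poly a ^ n"
  by (induction n) (auto simp: const_poly_mult)

lemma const_poly_of_int: "const_poly (of_int n) = of_int n"
  by (simp add: const_poly_def)

lemma lookup_const_poly_mult: "Poly_Mapping.lookup (const_poly a * p) m = a * Poly_Mapping.lookup p m"
proof -
  have "const_poly a * p = Poly_Mapping.map ((*) a) p"
    by (simp add: const_poly_def mult_map_scale_conv_mult)
  then show ?thesis by (simp add: Poly_Mapping.map.rep_eq when_def)
qed

lemma poly_eval_superset:
  assumes "finite K" "Poly_Mapping.keys p \<subseteq> K"
  shows "poly_eval p z = (\<Sum>m\<in>K. Poly_Mapping.lookup p m * (\<Prod>j\<in>UNIV. (z $ j) ^ Poly_Mapping.lookup m j))"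
  unfolding poly_eval_def using assms
  by (intro sum.mono_neutral_left) (auto simp: in_keys_iff)

lemma poly_eval_zero [simp]: "poly_eval 0 z = 0"
  by (simp add: poly_eval_def)

lemma poly_eval_single:
  "poly_eval (Poly_Mapping.single m c) z = c * (\<Prod>j\<in>UNIV. (z $ j) ^ Poly_Mapping.lookup m j)"
  by (subst poly_eval_superset[of "{m}"]) auto

lemma poly_eval_add: "poly_eval (p + q) z = poly_eval p z + poly_eval q z"
proof -
  let ?K = "Poly_Mapping.keys p \<union> Poly_Mapping.keys q"
  show ?thesis
    using keys_add[of p q]
    by (simp add: poly_eval_superset[of ?K] lookup_add distrib_right sum.distrib)
qed

lemma poly_eval_mult: "poly_eval (p * q) z = poly_eval p z * poly_eval q z"
proof (induction p rule: cpoly_induct)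
  case (single m c)
  show ?case
  proof (induction q rule: cpoly_induct)
    case (single m' c')
    then show ?case
      by (simp add: mult_single poly_eval_single lookup_add power_add prod.distrib)
  qed (auto simp: poly_eval_add distrib_left)
qed (auto simp: poly_eval_add distrib_right)

lemma poly_eval_sum: "poly_eval (sum h A) z = (\<Sum>i\<in>A. poly_eval (h i) z)"
  by (induction A rule: infinite_finite_induct) (auto simp: poly_eval_add)

lemma poly_eval_const: "poly_eval (const_poly c) z = c"
  by (simp add: const_poly_def poly_eval_single)

lemma var_poly_power: "var_poly j ^ n = Poly_Mapping.single (Poly_Mapping.single j n) (1::complex)"
  by (induction n) (auto simp: var_poly_def mult_single single_add[symmetric])

lemma single_eq_prod_var:
  fixes m :: "'k::finite \<Rightarrow>\<^sub>0 nat"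
  shows "Poly_Mapping.single m c = const_poly c * (\<Prod>j\<in>UNIV. var_poly j ^ Poly_Mapping.lookup m j)"
proof -
  have prod: "(\<Prod>j\<in>A. Poly_Mapping.single (Poly_Mapping.single j (Poly_Mapping.lookup m j)) (1::complex))
      = Poly_Mapping.single (\<Sum>j\<in>A. Poly_Mapping.single j (Poly_Mapping.lookup m j)) 1"
    if "finite A" for A :: "'k set"
    using that by (induction A) (auto simp: mult_single)
  have "(\<Sum>j\<in>UNIV. Poly_Mapping.single j (Poly_Mapping.lookup m j)) = m"
    by (rule poly_mapping_eqI) (simp add: lookup_sum lookup_single when_def)
  then show ?thesis by (simp add: var_poly_power prod const_poly_def mult_single)
qed

lemma poly_eval_congruent:
  assumes J: "ideal_set J" and var: "\<forall>k. var_poly k - const_poly (c $ k) \<in> J"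
  shows "p - const_poly (poly_eval p c) \<in> J"
proof -
  note JD = ideal_setD[OF J]
  have mult: "p * q - p' * q' \<in> J" if "p - p' \<in> J" "q - q' \<in> J" for p q p' q'
  proof -
    have "p * q - p' * q' = (p - p') * q + p' * (q - q')" by (simp add: algebra_simps)
    then show ?thesis using JD(2,3,4) that by simp
  qed
  have power: "p ^ n - q ^ n \<in> J" if "p - q \<in> J" for p q n
    using that by (induction n) (auto intro: mult simp: JD(1))
  have prod: "(\<Prod>j\<in>A. p j) - (\<Prod>j\<in>A. q j) \<in> J" if "finite A" "\<And>j. p j - q j \<in> J" for A :: "'a set" and p q
    using that by (induction A) (auto intro: mult simp: JD(1))
  show ?thesis
  proof (induction p rule: cpoly_induct)
    case zero
    then show ?case using JD(1) by simp
  next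
    case (single m x)
    have "(\<Prod>j\<in>UNIV. var_poly j ^ Poly_Mapping.lookup m j)
        - (\<Prod>j\<in>UNIV. const_poly (c $ j) ^ Poly_Mapping.lookup m j) \<in> J"
      using var by (intro prod power) auto
    from JD(3)[OF this, of "const_poly x"] show ?case
      unfolding poly_eval_single unfolding single_eq_prod_var[of m x]
      by (simp add: const_poly_mult const_poly_prod const_poly_power right_diff_distrib)
  next
    case (add p q)
    from JD(2)[OF this] show ?case by (simp add: poly_eval_add const_poly_add algebra_simps)
  qed
qed

section \<open>The Nullstellensatz over the complex numbers\<close>

definition eval_at :: "'k cpoly \<Rightarrow> complex poly \<Rightarrow> 'k cpoly" where
  "eval_at z P = poly (map_poly const_poly P) z"

lemma eval_at_pCons: "eval_at z (pCons a P) = const_poly a + z * eval_at z P"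
  by (simp add: eval_at_def map_poly_pCons)

lemma eval_at_0 [simp]: "eval_at z 0 = 0"
  by (simp add: eval_at_def)

lemma eval_at_1 [simp]: "eval_at z 1 = 1"
  by (simp add: eval_at_def)

lemma eval_at_add: "eval_at z (P + Q) = eval_at z P + eval_at z Q"
  by (induction P Q rule: poly_induct2) (auto simp: eval_at_pCons const_poly_add algebra_simps)

lemma eval_at_smult: "eval_at z (smult a P) = const_poly a * eval_at z P"
  by (induction P) (auto simp: eval_at_pCons const_poly_mult algebra_simps)

lemma eval_at_mult: "eval_at z (P * Q) = eval_at z P * eval_at z Q"
  by (induction P) (auto simp: eval_at_pCons eval_at_add eval_at_smult algebra_simps)

lemma eval_at_sum: "eval_at z (sum h A) = (\<Sum>i\<in>A. eval_at z (h i))"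
  by (induction A rule: infinite_finite_induct) (auto simp: eval_at_add)

lemma eval_at_prod: "eval_at z (prod h A) = (\<Prod>i\<in>A. eval_at z (h i))"
  by (induction A rule: infinite_finite_induct) (auto simp: eval_at_mult)

lemma eval_at_linear: "eval_at z [:- c, 1:] = z - const_poly c"
  by (simp add: eval_at_pCons const_poly_uminus)

text \<open>
  More unknowns \<open>a c\<close> than homogeneous equations, by Gaussian elimination of one equation. The
  vectors \<open>v c\<close> are a family and may repeat.
\<close>

lemma nontrivial_linear_relation:
  fixes v :: "'c \<Rightarrow> 'm \<Rightarrow> 'a::field"
  assumes "finite K" "finite C" "card K < card C"
  shows "\<exists>a. (\<exists>c\<in>C. a c \<noteq> 0) \<and> (\<forall>m\<in>K. (\<Sum>c\<in>C. a c * v c m) = 0)"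
  using assms
proof (induction K arbitrary: C v rule: finite_induct)
  case empty
  then have "C \<noteq> {}" by auto
  then show ?case by (intro exI[of _ "\<lambda>_. 1"]) auto
next
  case (insert k K)
  show ?case
  proof (cases "\<forall>c\<in>C. v c k = 0")
    case True
    have "card K < card C" using insert by simp
    with insert.IH[OF insert.prems(1)] obtain a
      where "\<exists>c\<in>C. a c \<noteq> 0" "\<forall>m\<in>K. (\<Sum>c\<in>C. a c * v c m) = 0" by metis
    with True show ?thesis by (intro exI[of _ a]) auto
  next
    case False
    then obtain c0 where c0: "c0 \<in> C" "v c0 k \<noteq> 0" by blast
    define D where "D = C - {c0}"
    have D: "finite D" "C = insert c0 D" "c0 \<notin> D" "card K < card D"
      using insert.prems insert.hyps c0 by (auto simp: D_def card_Diff_singleton)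
    obtain a where a: "\<exists>c\<in>D. a c \<noteq> 0"
      "\<forall>m\<in>K. (\<Sum>c\<in>D. a c * (v c m - v c k / v c0 k * v c0 m)) = 0"
      using insert.IH[OF D(1) D(4), of "\<lambda>c m. v c m - v c k / v c0 k * v c0 m"] by blast
    define b where "b = a(c0 := - (\<Sum>c\<in>D. a c * v c k) / v c0 k)"
    have sum_b: "(\<Sum>c\<in>C. b c * v c m) = b c0 * v c0 m + (\<Sum>c\<in>D. a c * v c m)" for m
    proof -
      have "(\<Sum>c\<in>D. b c * v c m) = (\<Sum>c\<in>D. a c * v c m)"
        using D by (intro sum.cong) (auto simp: b_def)
      then show ?thesis using D by simp
    qed
    have "(\<Sum>c\<in>C. b c * v c m) = 0" if "m \<in> insert k K" for m
    proof (cases "m = k")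
      case True
      then show ?thesis unfolding sum_b using c0 by (simp add: b_def)
    next
      case False
      with that a have "(\<Sum>c\<in>D. a c * (v c m - v c k / v c0 k * v c0 m)) = 0" by blast
      then have "(\<Sum>c\<in>D. a c * v c m) = (\<Sum>c\<in>D. a c * v c k) / v c0 k * v c0 m"
        by (simp add: right_diff_distrib sum_subtractf sum_distrib_left sum_distrib_right
            sum_divide_distrib mult_ac)
      then show ?thesis unfolding sum_b by (simp add: b_def)
    qed
    moreover have "\<exists>c\<in>C. b c \<noteq> 0" using a D by (auto simp: b_def)
    ultimately show ?thesis by blast
  qed
qed

lemma countable_exponents: "countable (UNIV :: ('k::finite \<Rightarrow>\<^sub>0 nat) set)"
proof -
  have "inj (Poly_Mapping.lookup :: ('k \<Rightarrow>\<^sub>0 nat) \<Rightarrow> 'k \<Rightarrow> nat)"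
    by (auto intro: injI poly_mapping_eqI)
  then show ?thesis by (rule countableI'[OF inj_compose[OF inj_to_nat], simplified comp_def])
qed

lemma uncountable_pigeonhole:
  assumes "uncountable A" "countable B" "h ` A \<subseteq> B"
  shows "\<exists>b\<in>B. infinite {a \<in> A. h a = b}"
proof (rule ccontr)
  assume "\<not> ?thesis"
  then have "countable (\<Union>b\<in>B. {a \<in> A. h a = b})"
    using assms(2) by (intro countable_UN) (auto intro: countable_finite)
  moreover have "A = (\<Union>b\<in>B. {a \<in> A. h a = b})" using assms(3) by auto
  ultimately show False using assms(1) by simp
qed

text \<open>
  The hypothesis \<open>inv\<close> says that every \<open>z - c\<close> becomes a unit modulo \<open>I\<close> once \<open>w\<close> is inverted. As
  \<open>P\<close> splits into linear factors over the complex numbers, \<open>P(z)\<close> becomes a unit as well.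
\<close>

lemma power_mem_if_shifts_meet_powers:
  assumes I: "ideal_set I"
    and inv: "\<And>c. \<exists>d s. w ^ d - s * (z - const_poly c) \<in> I"
    and "P \<noteq> 0" "w ^ d * eval_at z P \<in> I"
  shows "\<exists>e. w ^ e \<in> I"
  using assms(3,4)
proof (induction "degree P" arbitrary: P d)
  case 0
  then obtain a where P: "P = [:a:]" "a \<noteq> 0" by (metis degree_eq_zeroE pCons_0_0)
  have "const_poly (1/a) * (w ^ d * const_poly a) \<in> I"
    using 0 ideal_setD(3)[OF I] by (simp add: P eval_at_pCons)
  also have "const_poly (1/a) * (w ^ d * const_poly a) = const_poly (1/a * a) * w ^ d"
    by (simp only: const_poly_mult mult_ac)
  finally show ?case using P by auto
next
  case (Suc n)
  then have "\<not> constant (poly P)" by (simp add: constant_degree)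
  then obtain b where "poly P b = 0" using fundamental_theorem_of_algebra by blast
  then obtain Q where Q: "P = [:- b, 1:] * Q" by (metis dvdE poly_eq_0_iff_dvd)
  have "Q \<noteq> 0" using Suc.prems Q by auto
  then have "degree P = Suc (degree Q)" unfolding Q by (subst degree_mult_eq) auto
  then have deg: "n = degree Q" using Suc by simp
  obtain e s where es: "w ^ e - s * (z - const_poly b) \<in> I" using inv by blast
  have "w ^ d * eval_at z Q * (w ^ e - s * (z - const_poly b)) + s * (w ^ d * eval_at z P) \<in> I"
    using ideal_setD(2,3)[OF I] es Suc.prems by blast
  also have "w ^ d * eval_at z Q * (w ^ e - s * (z - const_poly b)) + s * (w ^ d * eval_at z P)
      = w ^ (d + e) * eval_at z Q"
    unfolding Q eval_at_mult eval_at_linear by (simp add: power_add algebra_simps)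
  finally show ?case using Suc.hyps(1)[OF deg \<open>Q \<noteq> 0\<close>] by blast
qed

text \<open>
  A proper ideal of the localisation at \<open>w\<close> stays proper after setting \<open>z\<close> to a suitable scalar
  \<open>c\<close>. Otherwise every \<open>z - c\<close> has, up to a power of \<open>w\<close>, an inverse \<open>ss c\<close> modulo \<open>I\<close>. There are
  uncountably many \<open>c\<close>, but only countably many pairs of an exponent and a finite set of monomials,
  so infinitely many of the \<open>ss c\<close> share both; these lie in one finite-dimensional space, hence
  are linearly dependent. Clearing denominators in a linear relation between the \<open>1/(z - c)\<close>
  gives a nonzero polynomial in \<open>z\<close> that vanishes in the localised quotient, which the previous
  lemma excludes.
\<close>

lemma exists_value_avoiding_powers:
  fixes w z :: "'k::finite cpoly"
  assumes I: "ideal_set I" and avoid: "\<And>d. w ^ d \<notin> I"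
  shows "\<exists>c. \<forall>d. w ^ d \<notin> ideal_adjoin I (z - const_poly c)"
proof (rule ccontr)
  assume "\<not> ?thesis"
  then have inv: "\<exists>d s. w ^ d - s * (z - const_poly c) \<in> I" for c
    unfolding ideal_adjoin_def by (smt (verit) add_diff_cancel_right' mem_Collect_eq)
  then obtain dd ss where ds: "\<And>c. w ^ dd c - ss c * (z - const_poly c) \<in> I" by metis
  have "countable ((UNIV :: nat set) \<times> {K :: ('k \<Rightarrow>\<^sub>0 nat) set. finite K})"
    using countable_Collect_finite_subset[OF countable_exponents] by (auto intro: countable_SIGMA)
  then obtain d K where "infinite {c. dd c = d \<and> Poly_Mapping.keys (ss c) = K}"
    using uncountable_pigeonhole[OF uncountable_UNIV_complex,
        of _ "\<lambda>c. (dd c, Poly_Mapping.keys (ss c))"]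
    by fastforce
  then obtain C where C: "finite C" "card C = Suc (card K)"
      "C \<subseteq> {c. dd c = d \<and> Poly_Mapping.keys (ss c) = K}"
    using infinite_arbitrarily_large by blast
  have "finite K"
    using C finite_keys by (metis (mono_tags, lifting) card.empty mem_Collect_eq nat.distinct(1) subset_eq subsetI subset_antisym empty_iff)
  then obtain a c0 where a: "c0 \<in> C" "a c0 \<noteq> 0"
      "\<forall>m\<in>K. (\<Sum>c\<in>C. a c * Poly_Mapping.lookup (ss c) m) = 0"
    using nontrivial_linear_relation[of K C "\<lambda>c. Poly_Mapping.lookup (ss c)"] C by auto
  have comb: "(\<Sum>c\<in>C. const_poly (a c) * ss c) = 0"
  proof (rule poly_mapping_eqI)
    fix m
    have "(\<Sum>c\<in>C. a c * Poly_Mapping.lookup (ss c) m) = 0"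
    proof (cases "m \<in> K")
      case False
      then show ?thesis using C by (intro sum.neutral) (auto simp: in_keys_iff)
    qed (use a in blast)
    then show "Poly_Mapping.lookup (\<Sum>c\<in>C. const_poly (a c) * ss c) m = Poly_Mapping.lookup 0 m"
      by (simp add: lookup_sum lookup_const_poly_mult)
  qed
  define P where "P = (\<Sum>c\<in>C. smult (a c) (\<Prod>l\<in>C-{c}. [:- l, 1:]))"
  \<comment> \<open>Every other summand of \<open>P\<close> contains the factor that vanishes at \<open>c0\<close>.\<close>
  have "poly P c0 = a c0 * (\<Prod>l\<in>C-{c0}. c0 - l)"
  proof -
    have "poly P c0 = (\<Sum>c\<in>C. a c * (\<Prod>l\<in>C-{c}. c0 - l))"
      by (simp add: P_def poly_sum poly_prod)
    also have "\<dots> = (\<Sum>c\<in>C. if c = c0 then a c0 * (\<Prod>l\<in>C-{c0}. c0 - l) else 0)"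
      using C a by (intro sum.cong refl) (auto intro!: prod_zero)
    finally show ?thesis using C a by simp
  qed
  then have "P \<noteq> 0" using a C by auto
  have "w ^ d * eval_at z P \<in> I"
  proof -
    define T where "T c = (\<Prod>l\<in>C-{c}. z - const_poly l)" for c
    have "(\<Sum>c\<in>C. const_poly (a c) * T c * (w ^ d - ss c * (z - const_poly c))) \<in> I"
      using C ds by (intro ideal_set_sum[OF I] ideal_setD(3)[OF I]) force
    also have "(\<Sum>c\<in>C. const_poly (a c) * T c * (w ^ d - ss c * (z - const_poly c)))
      = (\<Sum>c\<in>C. w ^ d * (const_poly (a c) * T c)) -
        (\<Sum>c\<in>C. (const_poly (a c) * ss c) * ((z - const_poly c) * T c))"
      by (simp add: right_diff_distrib sum_subtractf mult_ac)
    also have "(\<Sum>c\<in>C. (const_poly (a c) * ss c) * ((z - const_poly c) * T c))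
      = (\<Sum>c\<in>C. (const_poly (a c) * ss c) * (\<Prod>l\<in>C. z - const_poly l))"
      using C by (intro sum.cong) (auto simp: T_def prod.remove)
    also have "\<dots> = 0" using comb by (simp flip: sum_distrib_right)
    also have "(\<Sum>c\<in>C. w ^ d * (const_poly (a c) * T c)) = w ^ d * eval_at z P"
      by (simp add: P_def eval_at_sum eval_at_smult eval_at_prod eval_at_linear T_def sum_distrib_left)
    finally show ?thesis by simp
  qed
  from power_mem_if_shifts_meet_powers[OF I inv \<open>P \<noteq> 0\<close> this] avoid show False by blast
qed

text \<open>
  Specialising the variables one after the other produces a point at which \<open>J\<close>, and thus \<open>I\<close>,
  vanishes.
\<close>

lemma exists_point_avoiding_powers:
  fixes w :: "'k::finite cpoly"
  assumes I: "ideal_set I" and avoid: "\<And>d. w ^ d \<notin> I"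
  shows "\<exists>c J. ideal_set J \<and> I \<subseteq> J \<and> (\<forall>d. w ^ d \<notin> J)
    \<and> (\<forall>k. var_poly k - const_poly (c $ k) \<in> J)"
proof -
  have "\<exists>c J. ideal_set J \<and> I \<subseteq> J \<and> (\<forall>d. w ^ d \<notin> J)
    \<and> (\<forall>k\<in>B. var_poly k - const_poly (c k) \<in> J)" if "finite B" for B :: "'k set"
    using that
  proof (induction B rule: finite_induct)
    case empty
    then show ?case using I avoid by blast
  next
    case (insert k B)
    then obtain c J where J: "ideal_set J" "I \<subseteq> J" "\<forall>d. w ^ d \<notin> J"
      "\<forall>k\<in>B. var_poly k - const_poly (c k) \<in> J" by blast
    obtain x where x: "\<forall>d. w ^ d \<notin> ideal_adjoin J (var_poly k - const_poly x)"
      using exists_value_avoiding_powers[OF J(1)] J(3) by blast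
    let ?J = "ideal_adjoin J (var_poly k - const_poly x)"
    have "\<forall>l\<in>insert k B. var_poly l - const_poly ((c(k := x)) l) \<in> ?J"
      using insert.hyps J(4) ideal_adjoin_supset[of J] ideal_adjoin_mem[OF J(1)] by auto
    moreover have "I \<subseteq> ?J" using J(2) ideal_adjoin_supset[of J] by blast
    ultimately show ?case using x ideal_set_adjoin[OF J(1)] by blast
  qed
  from this[OF finite] obtain c J where J: "ideal_set J" "I \<subseteq> J" "\<forall>d. w ^ d \<notin> J"
      "\<forall>k\<in>UNIV. var_poly k - const_poly (c k) \<in> J" by blast
  then show ?thesis by (intro exI[of _ "\<chi> k. c k"] exI[of _ J]) simp
qed

text \<open>
  The point found for \<open>w = z\<^sub>k\<close> is a common zero of \<open>I\<close>, since \<open>p\<close> is congruent to the constant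
  \<open>p(c)\<close> modulo \<open>J\<close> and \<open>1 = w\<^sup>0\<close> is not in \<open>J\<close>; its \<open>k\<close>-th coordinate is nonzero, because
  otherwise \<open>w\<close> itself would lie in \<open>J\<close>.
\<close>

lemma nullstellensatz_coordinate:
  fixes I :: "'k::finite cpoly set"
  assumes I: "ideal_set I" and zeros: "\<And>c. (\<forall>p\<in>I. poly_eval p c = 0) \<Longrightarrow> c $ k = 0"
  shows "\<exists>d. var_poly k ^ d \<in> I"
proof (rule ccontr)
  assume "\<not> ?thesis"
  then obtain c J where J: "ideal_set J" "I \<subseteq> J" "\<forall>d. var_poly k ^ d \<notin> J"
      "\<forall>k. var_poly k - const_poly (c $ k) \<in> J"
    using exists_point_avoiding_powers[OF I, of "var_poly k"] by blast
  note JD = ideal_setD[OF J(1)]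
  have "poly_eval p c = 0" if "p \<in> I" for p
  proof (rule ccontr)
    assume nz: "poly_eval p c \<noteq> 0"
    have "p - (p - const_poly (poly_eval p c)) \<in> J"
      using JD(6) that J(2) poly_eval_congruent[OF J(1,4)] by blast
    then have "const_poly (1 / poly_eval p c) * const_poly (poly_eval p c) \<in> J"
      using JD(3) by simp
    then have "var_poly k ^ 0 \<in> J" using nz by (simp flip: const_poly_mult)
    with J(3) show False by blast
  qed
  then have "c $ k = 0" using zeros by blast
  then have "var_poly k ^ 1 \<in> J" using J(4)[rule_format, of k] by simp
  with J(3) show False by blast
qed

section \<open>Syzygies of polynomials without common zeros off the origin\<close>

lemma single_mult_eq_sum:
  fixes s :: "'k cpoly"
  shows "Poly_Mapping.single t 1 * s
    = (\<Sum>m\<in>Poly_Mapping.keys s. Poly_Mapping.single (t + m) (Poly_Mapping.lookup s m))"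
proof -
  have "Poly_Mapping.single t 1 * s
    = Poly_Mapping.single t 1 * (\<Sum>m\<in>Poly_Mapping.keys s. Poly_Mapping.single m (Poly_Mapping.lookup s m))"
    by (simp add: poly_mapping_sum_single)
  then show ?thesis by (simp add: sum_distrib_left mult_single)
qed

lemma lookup_single_mult_shift:
  fixes s :: "'k cpoly"
  shows "Poly_Mapping.lookup (Poly_Mapping.single t 1 * s) (t + m) = Poly_Mapping.lookup s m"
  by (auto simp: single_mult_eq_sum lookup_sum lookup_single when_def in_keys_iff)

text \<open>
  The monomial ideal generated by the powers \<open>z\<^sub>l\<close> to the \<open>d l\<close> with \<open>l \<in> L\<close>, described by the
  monomials that it contains, which reduces membership to a test on exponents.
\<close>

definition power_ideal :: "('k \<Rightarrow> nat) \<Rightarrow> 'k set \<Rightarrow> 'k cpoly set" where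
  "power_ideal d L = {p. \<forall>m\<in>Poly_Mapping.keys p. \<exists>l\<in>L. d l \<le> Poly_Mapping.lookup m l}"

lemma power_ideal_empty: "power_ideal d {} = {0}"
  by (auto simp: power_ideal_def intro: poly_mapping_eqI simp: in_keys_iff)

lemma ideal_set_power_ideal: "ideal_set (power_ideal d L)"
proof -
  have "s * x \<in> power_ideal d L" if "x \<in> power_ideal d L" for s x
    unfolding power_ideal_def
  proof (intro CollectI ballI)
    fix m assume "m \<in> Poly_Mapping.keys (s * x)"
    then obtain a b where "m = a + b" "b \<in> Poly_Mapping.keys x" using keys_mult[of s x] by blast
    with that show "\<exists>l\<in>L. d l \<le> Poly_Mapping.lookup m l"
      by (force simp: power_ideal_def lookup_add)
  qed
  moreover have "x + y \<in> power_ideal d L" if "x \<in> power_ideal d L" "y \<in> power_ideal d L" for x y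
    using that keys_add[of x y] by (fastforce simp: power_ideal_def)
  moreover have "0 \<in> power_ideal d L" by (simp add: power_ideal_def)
  ultimately show ?thesis by (simp add: ideal_set_def)
qed

text \<open>
  Multiplication by a power of \<open>z\<^sub>k\<close> shifts exponents in the direction \<open>k\<close> only, and the
  conditions defining the ideal concern the other directions.
\<close>

lemma var_power_regular:
  assumes "k \<notin> L" and "var_poly k ^ d k * s \<in> power_ideal d L"
  shows "s \<in> power_ideal d L"
  unfolding power_ideal_def
proof (intro CollectI ballI)
  fix m assume "m \<in> Poly_Mapping.keys s"
  then have "Poly_Mapping.single k (d k) + m \<in> Poly_Mapping.keys (var_poly k ^ d k * s)"
    by (simp add: var_poly_power in_keys_iff lookup_single_mult_shift)
  with assms(2) obtain l where "l \<in> L" "d l \<le> Poly_Mapping.lookup (Poly_Mapping.single k (d k) + m) l"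
    by (auto simp: power_ideal_def)
  then show "\<exists>l\<in>L. d l \<le> Poly_Mapping.lookup m l"
    using assms(1) by (intro bexI[of _ l]) (auto simp: lookup_add lookup_single when_def split: if_splits)
qed

lemma power_ideal_insert:
  assumes "p \<in> power_ideal d (insert k L)"
  shows "\<exists>s. p - var_poly k ^ d k * s \<in> power_ideal d L"
proof -
  define t where "t = Poly_Mapping.single k (d k)"
  define M where "M = {m \<in> Poly_Mapping.keys p. d k \<le> Poly_Mapping.lookup m k}"
  define s where "s = (\<Sum>m\<in>M. Poly_Mapping.single (m - t) (Poly_Mapping.lookup p m))"
  have "t + (m - t) = m" if "m \<in> M" for m
    using that by (intro poly_mapping_eqI) (auto simp: M_def t_def lookup_add lookup_minus lookup_single when_def)
  then have "var_poly k ^ d k * s = (\<Sum>m\<in>M. Poly_Mapping.single m (Poly_Mapping.lookup p m))"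
    unfolding s_def var_poly_power t_def[symmetric] by (simp add: sum_distrib_left mult_single)
  then have "Poly_Mapping.lookup (var_poly k ^ d k * s) m = (if m \<in> M then Poly_Mapping.lookup p m else 0)" for m
    by (simp add: lookup_sum lookup_single when_def) (auto simp: M_def)
  then have "Poly_Mapping.keys (p - var_poly k ^ d k * s) \<subseteq> Poly_Mapping.keys p - M"
    by (auto simp: in_keys_iff lookup_minus split: if_splits)
  then show ?thesis
    using assms unfolding power_ideal_def M_def by (intro exI[of _ s]) blast
qed

lemma var_power_mem_insert: "var_poly k ^ d k \<in> power_ideal d (insert k L)"
  by (auto simp: power_ideal_def var_poly_power)

text \<open>
  Descending induction on \<open>L\<close>. For \<open>L = UNIV\<close> the degree exceeds the number of variables, where
  the only chain is zero; removing one index from \<open>L\<close> lowers the degree by one.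
\<close>

lemma koszul_exact_power_ideal:
  fixes f :: "'k::{finite,linorder} \<Rightarrow> 'k cpoly"
  assumes h: "\<And>k. var_poly k ^ d k = (\<Sum>i\<in>UNIV. h k i * f i)"
  shows "koszul_exact f (power_ideal d L) (Suc (card L))"
proof (induction "card (- L)" arbitrary: L)
  case 0
  then have "L = UNIV" by auto
  then show ?case by (intro koszul_exact_top ideal_set_power_ideal) simp
next
  case (Suc n)
  then have "- L \<noteq> {}" by auto
  then obtain k where k: "k \<notin> L" by blast
  have "n = card (- insert k L)"
    using Suc(2) k by (simp add: Compl_insert card_Diff_singleton)
  from Suc(1)[OF this] k have "koszul_exact f (power_ideal d (insert k L)) (Suc (Suc (card L)))"
    by simp
  then show ?case
    by (rule koszul_exact_step[OF ideal_set_power_ideal ideal_set_power_ideal _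
          var_power_mem_insert power_ideal_insert var_power_regular[OF k] h, rotated 3])
       (auto simp: power_ideal_def)
qed

text \<open>
  A family of as many polynomials as variables whose common zeros are at most the origin has no
  syzygies but those generated by the trivial ones \<open>f\<^sub>j e\<^sub>k - f\<^sub>k e\<^sub>j\<close>. A syzygy is a
  cycle of degree 1, and by the Nullstellensatz the ideal \<open>(f)\<close> contains a power of each
  variable, so the preceding lemma applies with \<open>L = {}\<close>.
\<close>

lemma syzygies_are_koszul:
  fixes f Y :: "'k::{finite,linorder} \<Rightarrow> 'k cpoly"
  assumes zeros: "\<And>z. (\<forall>j. poly_eval (f j) z = 0) \<Longrightarrow> z = 0"
    and syzygy: "(\<Sum>j\<in>UNIV. Y j * f j) = 0"
  shows "\<exists>P. \<forall>k. Y k = (\<Sum>j\<in>{..<k}. P j k * f j) - (\<Sum>l\<in>{k<..}. P k l * f l)"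
proof -
  define I where "I = {(\<Sum>i\<in>UNIV. h i * f i) | h. True}"
  have memI: "(\<Sum>i\<in>UNIV. h i * f i) \<in> I" for h by (auto simp: I_def)
  have "ideal_set I"
    unfolding ideal_set_def
  proof (intro conjI ballI allI)
    show "0 \<in> I" using memI[of "\<lambda>_. 0"] by simp
  next
    fix x y assume "x \<in> I" "y \<in> I"
    then obtain h h' where "x = (\<Sum>i\<in>UNIV. h i * f i)" "y = (\<Sum>i\<in>UNIV. h' i * f i)"
      by (auto simp: I_def)
    then show "x + y \<in> I" using memI[of "\<lambda>i. h i + h' i"] by (simp add: distrib_right sum.distrib)
  next
    fix s x assume "x \<in> I"
    then obtain h where "x = (\<Sum>i\<in>UNIV. h i * f i)" by (auto simp: I_def)
    then show "s * x \<in> I" using memI[of "\<lambda>i. s * h i"] by (simp add: sum_distrib_left mult_ac)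
  qed
  moreover have "f j \<in> I" for j
    using memI[of "\<lambda>i. if i = j then 1 else 0"] by (simp add: if_distrib[of "\<lambda>x. x * _"] cong: if_cong)
  moreover from this have "c $ k = 0" if "\<forall>p\<in>I. poly_eval p c = 0" for c k
    using zeros[of c] that by simp
  ultimately have "\<exists>d. var_poly k ^ d \<in> I" for k
    by (intro nullstellensatz_coordinate) auto
  then have "\<exists>d h. var_poly k ^ d = (\<Sum>i\<in>UNIV. h i * f i)" for k
    by (auto simp: I_def)
  then obtain d h where "\<And>k. var_poly k ^ d k = (\<Sum>i\<in>UNIV. h k i * f i)" by metis
  from koszul_exact_power_ideal[of d h f "{}", OF this]
  have exact: "koszul_exact f {0} 1" by (simp add: power_ideal_empty)
  define c where "c A = (if card A = 1 then Y (the_elem A) else 0)" for A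
  have "contract f c A = 0" for A
  proof (cases "A = {}")
    case True
    then show ?thesis
      using syzygy by (simp add: contract_def c_def koszul_sign_def mult.commute)
  next
    case False
    have "c (insert i A) = 0" if "i \<notin> A" for i
      using False that by (simp add: c_def)
    then show ?thesis by (simp add: contract_def)
  qed
  moreover have "\<forall>A. card A \<noteq> 1 \<longrightarrow> c A = 0" by (simp add: c_def)
  ultimately obtain b where "\<forall>A. c A - contract f b A \<in> {0}"
    using exact unfolding koszul_exact_def by blast
  then have b: "c A = contract f b A" for A by simp
  have "Y k = (\<Sum>j\<in>{..<k}. b {j, k} * f j) - (\<Sum>l\<in>{k<..}. b {k, l} * f l)" for k
  proof -
    have sign: "koszul_sign i {k} = (if k < i then - 1 else 1 :: 'k cpoly)" for i
      using koszul_sign_insert[of k "{}" i, where 'a="'k cpoly"] by (simp add: koszul_sign_def)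
    have "Y k = contract f b {k}" using b[of "{k}"] by (simp add: c_def)
    also have "\<dots> = (\<Sum>i\<in>{..<k} \<union> {k<..}. koszul_sign i {k} * f i * b {i, k})"
      unfolding contract_def by (intro sum.cong) auto
    also have "\<dots> = (\<Sum>i\<in>{..<k}. koszul_sign i {k} * f i * b {i, k})
        + (\<Sum>i\<in>{k<..}. koszul_sign i {k} * f i * b {i, k})"
      by (rule sum.union_disjoint) auto
    also have "(\<Sum>i\<in>{..<k}. koszul_sign i {k} * f i * b {i, k}) = (\<Sum>i\<in>{..<k}. b {i, k} * f i)"
      by (intro sum.cong) (auto simp: sign)
    also have "(\<Sum>i\<in>{k<..}. koszul_sign i {k} * f i * b {i, k}) = - (\<Sum>i\<in>{k<..}. b {k, i} * f i)"
      unfolding sum_negf[symmetric] by (intro sum.cong) (auto simp: sign insert_commute)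
    finally show ?thesis by simp
  qed
  then show ?thesis by (intro exI[of _ "\<lambda>j k. b {j, k}"]) blast
qed

section \<open>The grading by the divisor class group\<close>

lemma additive_diff:
  fixes m m' :: "'a::ab_group_add \<Rightarrow> int"
  assumes "Modules.additive m" "Modules.additive m'"
  shows "Modules.additive (\<lambda>x. m x - m' x)"
  using assms by (auto simp: Modules.additive_def)

lemma principal_divisors_diff:
  assumes "D \<in> principal_divisors u" "E \<in> principal_divisors u"
  shows "D - E \<in> principal_divisors u"
proof -
  obtain m m' where *: "Modules.additive m" "Modules.additive m'"
      "D = (\<chi> j. m (u j))" "E = (\<chi> j. m' (u j))"
    using assms by (auto simp: principal_divisors_def)
  then have "D - E = (\<chi> j. m (u j) - m' (u j))" by (simp add: vec_eq_iff)
  with additive_diff[OF *(1,2)] show ?thesis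
    unfolding principal_divisors_def by (intro CollectI exI[of _ "\<lambda>x. m x - m' x"]) simp
qed

lemma principal_divisors_zero: "0 \<in> principal_divisors u"
  unfolding principal_divisors_def
  by (auto simp: Modules.additive_def vec_eq_iff intro!: exI[of _ "\<lambda>_. 0"])

lemma principal_divisors_add:
  assumes "D \<in> principal_divisors u" "E \<in> principal_divisors u"
  shows "D + E \<in> principal_divisors u"
  using principal_divisors_diff[OF assms(1)
      principal_divisors_diff[OF principal_divisors_zero assms(2)]] by simp

lemma divisor_class_eq: "divisor_class u D = {l + D | l. l \<in> principal_divisors u}"
  by (auto simp: divisor_class_def r_coset_def divisor_group_def)

lemma divisor_class_eq_iff: "divisor_class u D = divisor_class u E \<longleftrightarrow> D - E \<in> principal_divisors u"
proof
  assume "divisor_class u D = divisor_class u E"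
  moreover have "0 + D \<in> divisor_class u D"
    unfolding divisor_class_eq using principal_divisors_zero by blast
  ultimately obtain l where "l \<in> principal_divisors u" "D = l + E"
    by (auto simp: divisor_class_eq)
  then show "D - E \<in> principal_divisors u" by simp
next
  have sub: "divisor_class u D \<subseteq> divisor_class u E" if "D - E \<in> principal_divisors u" for D E
  proof
    fix x assume "x \<in> divisor_class u D"
    then obtain l where "l \<in> principal_divisors u" "x = (l + (D - E)) + E"
      by (auto simp: divisor_class_eq)
    then show "x \<in> divisor_class u E"
      unfolding divisor_class_eq using principal_divisors_add[OF _ that] by blast
  qed
  assume D: "D - E \<in> principal_divisors u"
  moreover have "E - D \<in> principal_divisors u"
    using principal_divisors_diff[OF principal_divisors_zero D] by simp
  ultimately show "divisor_class u D = divisor_class u E" using sub by blast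
qed

lemma carrier_class_group: "carrier (class_group u) = range (divisor_class u)"
  by (auto simp: class_group_def FactGroup_def RCOSETS_def divisor_class_def divisor_group_def)

lemma divisor_class_mult:
  "divisor_class u D \<otimes>\<^bsub>class_group u\<^esub> divisor_class u E = divisor_class u (D + E)"
proof -
  have "divisor_class u D \<otimes>\<^bsub>class_group u\<^esub> divisor_class u E
    = {x + y | x y. x \<in> divisor_class u D \<and> y \<in> divisor_class u E}"
    by (auto simp: class_group_def FactGroup_def set_mult_def divisor_group_def)
  also have "\<dots> = divisor_class u (D + E)"
  proof (intro equalityI subsetI)
    fix z assume "z \<in> {x + y | x y. x \<in> divisor_class u D \<and> y \<in> divisor_class u E}"
    then obtain l l' where l: "l \<in> principal_divisors u" "l' \<in> principal_divisors u"
        "z = (l + l') + (D + E)"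
      by (auto simp: divisor_class_eq algebra_simps)
    with principal_divisors_add[OF l(1,2)] show "z \<in> divisor_class u (D + E)"
      unfolding divisor_class_eq by blast
  next
    fix z assume "z \<in> divisor_class u (D + E)"
    then obtain l where l: "l \<in> principal_divisors u" "z = (l + D) + (0 + E)"
      by (auto simp: divisor_class_eq algebra_simps)
    then show "z \<in> {x + y | x y. x \<in> divisor_class u D \<and> y \<in> divisor_class u E}"
      unfolding divisor_class_eq using principal_divisors_zero[of u] by blast
  qed
  finally show ?thesis .
qed

definition exponent_vec :: "('k::finite \<Rightarrow>\<^sub>0 nat) \<Rightarrow> int ^ 'k" where
  "exponent_vec m = (\<chi> j. int (Poly_Mapping.lookup m j))"

lemma exponent_vec_add: "exponent_vec (m + m') = exponent_vec m + exponent_vec m'"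
  by (simp add: exponent_vec_def vec_eq_iff lookup_add)

lemma exponent_vec_zero: "exponent_vec 0 = 0"
  by (simp add: exponent_vec_def vec_eq_iff)

lemma exponent_vec_single: "exponent_vec (Poly_Mapping.single j 1) = axis j 1"
  by (simp add: exponent_vec_def vec_eq_iff axis_def lookup_single when_def)

lemma graded_piece_iff:
  "p \<in> graded_piece u (divisor_class u D) \<longleftrightarrow>
    (\<forall>m\<in>Poly_Mapping.keys p. exponent_vec m - D \<in> principal_divisors u)"
  by (simp add: graded_piece_def exponent_vec_def[symmetric] divisor_class_eq_iff)

definition hom_part :: "('k::finite \<Rightarrow> int ^ 'n) \<Rightarrow> int ^ 'k \<Rightarrow> 'k cpoly \<Rightarrow> 'k cpoly" where
  "hom_part u D p =
     Poly_Mapping.mapp (\<lambda>m c. if exponent_vec m - D \<in> principal_divisors u then c else 0) p"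

lemma lookup_hom_part: "Poly_Mapping.lookup (hom_part u D p) m =
    (if exponent_vec m - D \<in> principal_divisors u then Poly_Mapping.lookup p m else 0)"
  by (auto simp: hom_part_def lookup_mapp when_def in_keys_iff)

lemma hom_part_graded: "hom_part u D p \<in> graded_piece u (divisor_class u D)"
  by (auto simp: graded_piece_iff in_keys_iff lookup_hom_part split: if_splits)

lemma quasi_homogeneous_hom_part: "quasi_homogeneous u (hom_part u D p)"
  using hom_part_graded[of u D p] by (auto simp: quasi_homogeneous_def carrier_class_group)

lemma hom_part_add: "hom_part u D (p + q) = hom_part u D p + hom_part u D q"
  by (rule poly_mapping_eqI) (simp add: lookup_hom_part lookup_add)

lemma hom_part_diff: "hom_part u D (p - q) = hom_part u D p - hom_part u D q"
  by (rule poly_mapping_eqI) (simp add: lookup_hom_part lookup_minus)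

lemma hom_part_sum: "hom_part u D (sum h A) = (\<Sum>i\<in>A. hom_part u D (h i))"
  by (rule poly_mapping_eqI) (simp add: lookup_hom_part lookup_sum)

lemma hom_part_ident:
  assumes "p \<in> graded_piece u (divisor_class u D)"
  shows "hom_part u D p = p"
  using assms by (intro poly_mapping_eqI) (auto simp: graded_piece_iff in_keys_iff lookup_hom_part)

lemma graded_piece_mult:
  assumes "p \<in> graded_piece u (divisor_class u D)" "q \<in> graded_piece u (divisor_class u E)"
  shows "p * q \<in> graded_piece u (divisor_class u (D + E))"
  unfolding graded_piece_iff
proof
  fix m assume "m \<in> Poly_Mapping.keys (p * q)"
  then obtain a b where ab: "m = a + b" "a \<in> Poly_Mapping.keys p" "b \<in> Poly_Mapping.keys q"
    using keys_mult[of p q] by blast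
  then have "(exponent_vec a - D) + (exponent_vec b - E) \<in> principal_divisors u"
    using assms by (intro principal_divisors_add) (auto simp: graded_piece_iff)
  then show "exponent_vec m - (D + E) \<in> principal_divisors u"
    by (simp add: ab exponent_vec_add algebra_simps)
qed

lemma graded_piece_sum:
  assumes "\<And>i. i \<in> A \<Longrightarrow> h i \<in> graded_piece u (divisor_class u D)"
  shows "sum h A \<in> graded_piece u (divisor_class u D)"
proof -
  have "hom_part u D (sum h A) = sum h A"
    using assms by (simp add: hom_part_sum hom_part_ident)
  then show ?thesis using hom_part_graded by metis
qed

text \<open>
  The remainder \<open>p'\<close> has no monomial of degree \<open>D\<close>, and multiplication by the homogeneous \<open>q\<close>
  shifts every degree by \<open>E\<close>; cancellation in the class group keeps degree \<open>D + E\<close> absent.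
\<close>

lemma hom_part_mult:
  assumes q: "q \<in> graded_piece u (divisor_class u E)"
  shows "hom_part u (D + E) (p * q) = hom_part u D p * q"
proof -
  define p' where "p' = p - hom_part u D p"
  have "hom_part u (D + E) (p' * q) = 0"
  proof (rule poly_mapping_eqI)
    fix m
    have "exponent_vec m - (D + E) \<notin> principal_divisors u" if "m \<in> Poly_Mapping.keys (p' * q)"
    proof
      assume "exponent_vec m - (D + E) \<in> principal_divisors u"
      moreover from that obtain a b
        where ab: "m = a + b" "a \<in> Poly_Mapping.keys p'" "b \<in> Poly_Mapping.keys q"
        using keys_mult[of p' q] by blast
      moreover have "exponent_vec b - E \<in> principal_divisors u"
        using q ab by (auto simp: graded_piece_iff)
      ultimately have "(exponent_vec m - (D + E)) - (exponent_vec b - E) \<in> principal_divisors u"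
        using principal_divisors_diff by blast
      then have "exponent_vec a - D \<in> principal_divisors u"
        by (simp add: ab exponent_vec_add algebra_simps)
      then show False using ab by (simp add: p'_def in_keys_iff lookup_minus lookup_hom_part)
    qed
    then show "Poly_Mapping.lookup (hom_part u (D + E) (p' * q)) m = Poly_Mapping.lookup 0 m"
      by (auto simp: lookup_hom_part in_keys_iff)
  qed
  moreover have "hom_part u (D + E) (hom_part u D p * q) = hom_part u D p * q"
    by (intro hom_part_ident graded_piece_mult hom_part_graded q)
  moreover have "p * q = hom_part u D p * q + p' * q" by (simp add: p'_def algebra_simps)
  ultimately show ?thesis by (simp add: hom_part_add)
qed

lemma graded_const: "const_poly c \<in> graded_piece u (divisor_class u 0)"
  using principal_divisors_zero[of u]
  by (auto simp: graded_piece_iff const_poly_def exponent_vec_zero)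

lemma graded_var: "var_poly j \<in> graded_piece u (divisor_class u (axis j 1))"
  using exponent_vec_single[of j] principal_divisors_zero
  by (auto simp: graded_piece_iff var_poly_def)

section \<open>Partial derivatives and the Euler formula\<close>

lemma lookup_pdiff: "Poly_Mapping.lookup (pdiff j p) m
    = of_nat (Suc (Poly_Mapping.lookup m j)) * Poly_Mapping.lookup p (m + Poly_Mapping.single j 1)"
proof -
  let ?e = "Poly_Mapping.single j (1::nat)"
  let ?g = "\<lambda>m'. of_nat (Poly_Mapping.lookup m' j) * Poly_Mapping.lookup p m'"
  have "Poly_Mapping.lookup (pdiff j p) m = (\<Sum>m'\<in>Poly_Mapping.keys p. (?g m' when m' - ?e = m))"
    unfolding pdiff_def lookup_sum lookup_single ..
  also have "\<dots> = (\<Sum>m'\<in>Poly_Mapping.keys p. if m' = m + ?e then ?g m' else 0)"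
  proof (rule sum.cong[OF refl])
    fix m'
    show "(?g m' when m' - ?e = m) = (if m' = m + ?e then ?g m' else 0)"
    proof (cases "Poly_Mapping.lookup m' j = 0")
      case True
      then have "m' \<noteq> m + ?e" by (auto simp: lookup_add)
      then show ?thesis using True by simp
    next
      case False
      then have "m' - ?e + ?e = m'"
        by (intro poly_mapping_eqI) (auto simp: lookup_add lookup_minus lookup_single when_def)
      then have "m' - ?e = m \<longleftrightarrow> m' = m + ?e" by (metis add_diff_cancel_right')
      then show ?thesis by (simp only: when_def)
    qed
  qed
  also have "\<dots> = ?g (m + ?e)" by (auto simp: in_keys_iff)
  finally show ?thesis by (simp add: lookup_add)
qed

lemma graded_pdiff:
  assumes "p \<in> graded_piece u (divisor_class u D)"
  shows "pdiff j p \<in> graded_piece u (divisor_class u (D - axis j 1))"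
  unfolding graded_piece_iff
proof
  fix m assume "m \<in> Poly_Mapping.keys (pdiff j p)"
  then have "m + Poly_Mapping.single j 1 \<in> Poly_Mapping.keys p"
    by (auto simp: in_keys_iff lookup_pdiff)
  with assms have "exponent_vec (m + Poly_Mapping.single j 1) - D \<in> principal_divisors u"
    by (simp add: graded_piece_iff)
  then show "exponent_vec m - (D - axis j 1) \<in> principal_divisors u"
    unfolding exponent_vec_add exponent_vec_single by (simp add: algebra_simps)
qed

lemma lookup_var_pdiff: "Poly_Mapping.lookup (var_poly j * pdiff j p) m
    = of_nat (Poly_Mapping.lookup m j) * Poly_Mapping.lookup p m"
proof (cases "Poly_Mapping.lookup m j = 0")
  case True
  have "m \<notin> Poly_Mapping.keys (var_poly j * pdiff j p)"
  proof
    assume "m \<in> Poly_Mapping.keys (var_poly j * pdiff j p)"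
    then obtain b where "m = Poly_Mapping.single j 1 + b"
      using keys_mult[of "var_poly j" "pdiff j p"] by (auto simp: var_poly_def)
    with True show False by (simp add: lookup_add)
  qed
  then show ?thesis using True by (simp add: in_keys_iff)
next
  case False
  define m' where "m' = m - Poly_Mapping.single j 1"
  have m: "m = Poly_Mapping.single j 1 + m'"
    using False by (intro poly_mapping_eqI) (auto simp: m'_def lookup_add lookup_minus lookup_single when_def)
  show ?thesis
    unfolding m var_poly_def lookup_single_mult_shift lookup_pdiff
    by (simp add: lookup_add add.commute)
qed

text \<open>
  Pairing the relation \<open>b\<close> with the divisor of a character \<open>m\<close> gives \<open>m\<close> of the combination
  \<open>\<Sum>\<^sub>j b\<^sub>j u\<^sub>j\<close>, which is zero. Hence \<open>b\<close> induces an integer weight on the class group.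
\<close>

lemma relation_pairing_principal:
  fixes u :: "'k::finite \<Rightarrow> int ^ 'n"
  assumes rel: "(\<Sum>j\<in>UNIV. b $ j *s u j) = 0" and D: "D \<in> principal_divisors u"
  shows "(\<Sum>j\<in>UNIV. b $ j * D $ j) = 0"
proof -
  obtain m where m: "Modules.additive m" "D = (\<chi> j. m (u j))"
    using D by (auto simp: principal_divisors_def)
  interpret Modules.additive m by fact
  have scale_nat: "m (int n *s v) = int n * m v" for n v
  proof (induction n)
    case (Suc n)
    have "int (Suc n) *s v = v + int n *s v" by (simp add: vec_eq_iff algebra_simps)
    then show ?case using Suc by (simp add: add algebra_simps)
  qed (simp add: zero)
  have scale: "m (c *s v) = c * m v" for c v
  proof (cases c)
    case (neg n)
    then have "c *s v = - (int (Suc n) *s v)" by (simp add: vec_eq_iff)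
    then show ?thesis using neg by (simp only: minus scale_nat)
  qed (use scale_nat in auto)
  have "(\<Sum>j\<in>UNIV. b $ j * D $ j) = m (\<Sum>j\<in>UNIV. b $ j *s u j)"
    by (simp add: m(2) sum scale)
  then show ?thesis using rel zero by simp
qed

text \<open>
  A monomial with exponent \<open>m\<close> is an eigenvector of the Euler field with eigenvalue \<open>\<Sum>\<^sub>j b\<^sub>j m\<^sub>j\<close>,
  and this number depends only on the degree of the monomial.
\<close>

lemma euler_formula:
  fixes u :: "'k::finite \<Rightarrow> int ^ 'n"
  assumes rel: "(\<Sum>j\<in>UNIV. b $ j *s u j) = 0" and f: "f \<in> graded_piece u (divisor_class u D)"
  shows "(\<Sum>j\<in>UNIV. of_int (b $ j) * var_poly j * pdiff j f)
    = const_poly (of_int (\<Sum>j\<in>UNIV. b $ j * D $ j)) * f"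
proof (rule poly_mapping_eqI)
  fix m
  have "of_int (b $ j) * var_poly j * pdiff j f = const_poly (of_int (b $ j)) * (var_poly j * pdiff j f)"
    for j by (simp only: const_poly_of_int mult.assoc)
  then have "Poly_Mapping.lookup (\<Sum>j\<in>UNIV. of_int (b $ j) * var_poly j * pdiff j f) m
      = (\<Sum>j\<in>UNIV. of_int (b $ j) * (of_nat (Poly_Mapping.lookup m j) * Poly_Mapping.lookup f m))"
    by (simp only: lookup_sum lookup_const_poly_mult lookup_var_pdiff)
  also have "\<dots> = of_int (\<Sum>j\<in>UNIV. b $ j * exponent_vec m $ j) * Poly_Mapping.lookup f m"
    by (simp add: exponent_vec_def sum_distrib_right mult.assoc)
  also have "\<dots> = of_int (\<Sum>j\<in>UNIV. b $ j * D $ j) * Poly_Mapping.lookup f m"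
  proof (cases "m \<in> Poly_Mapping.keys f")
    case True
    with f have "exponent_vec m - D \<in> principal_divisors u" by (simp add: graded_piece_iff)
    from relation_pairing_principal[OF rel this]
    have "(\<Sum>j\<in>UNIV. b $ j * exponent_vec m $ j) = (\<Sum>j\<in>UNIV. b $ j * D $ j)"
      by (simp add: right_diff_distrib sum_subtractf)
    then show ?thesis by simp
  qed (simp add: in_keys_iff)
  finally show "Poly_Mapping.lookup (\<Sum>j\<in>UNIV. of_int (b $ j) * var_poly j * pdiff j f) m
      = Poly_Mapping.lookup (const_poly (of_int (\<Sum>j\<in>UNIV. b $ j * D $ j)) * f) m"
    by (simp add: lookup_const_poly_mult)
qed

lemma euler_formula_weight:
  fixes u :: "'k::finite \<Rightarrow> int ^ 'n"
  assumes rel: "(\<Sum>j\<in>UNIV. b $ j *s u j) = 0"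
    and \<alpha>: "\<alpha> \<in> carrier (class_group u)" and f: "f \<in> graded_piece u \<alpha>" "f \<noteq> 0"
  shows "(\<Sum>j\<in>UNIV. of_int (b $ j) * var_poly j * pdiff j f) = const_poly (euler_weight u b \<alpha>) * f"
proof -
  obtain D where D: "\<alpha> = divisor_class u D" using \<alpha> by (auto simp: carrier_class_group)
  define t :: complex where "t = of_int (\<Sum>j\<in>UNIV. b $ j * D $ j)"
  have t: "(\<Sum>j\<in>UNIV. of_int (b $ j) * var_poly j * pdiff j f') = const_poly t * f'"
    if "f' \<in> graded_piece u \<alpha>" for f'
    using euler_formula[OF rel, of f' D] that by (simp add: D t_def)
  have "euler_weight u b \<alpha> = t"
    unfolding euler_weight_def
  proof (rule the_equality)
    fix t' assume t': "\<forall>f\<in>graded_piece u \<alpha>.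
      (\<Sum>j\<in>UNIV. of_int (b $ j) * var_poly j * pdiff j f) = const_poly t' * f"
    have eq: "const_poly t' * f = const_poly t * f"
      using t[OF f(1)] bspec[OF t' f(1)] by (rule trans[OF sym, rotated])
    obtain m where "Poly_Mapping.lookup f m \<noteq> 0"
      using f(2) by (auto simp: poly_mapping_eq_iff fun_eq_iff)
    then show "t' = t"
      using arg_cong[OF eq, of "\<lambda>p. Poly_Mapping.lookup p m"] by (simp add: lookup_const_poly_mult)
  qed (use t in blast)
  then show ?thesis using t f by simp
qed

text \<open>
  For \<open>f = 0\<close> the point with all coordinates 1 would be a singular zero.
\<close>

lemma strongly_quasi_smooth_nonzero:
  assumes "strongly_quasi_smooth (f :: 'k::finite cpoly)"
  shows "f \<noteq> 0"
proof
  assume "f = 0"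
  moreover have "(1 :: complex ^ 'k) \<noteq> 0" by simp
  ultimately show False
    using assms by (auto simp: strongly_quasi_smooth_def pdiff_def)
qed

text \<open>
  Where all partial derivatives vanish, the Euler formula makes \<open>t f\<close> and hence \<open>f\<close> vanish, so
  the point would be singular on the tangent cone.
\<close>

lemma common_zeros_of_partials:
  fixes f :: "'k::finite cpoly"
  assumes smooth: "strongly_quasi_smooth f"
    and euler: "(\<Sum>j\<in>UNIV. of_int (b $ j) * var_poly j * pdiff j f) = const_poly t * f" and "t \<noteq> 0"
    and zero: "\<forall>j. poly_eval (pdiff j f) z = 0"
  shows "z = 0"
proof (rule ccontr)
  assume "z \<noteq> 0"
  have "t * poly_eval f z = poly_eval (\<Sum>j\<in>UNIV. of_int (b $ j) * var_poly j * pdiff j f) z"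
    by (simp add: euler poly_eval_mult poly_eval_const)
  also have "\<dots> = 0" using zero by (simp add: poly_eval_sum poly_eval_mult)
  finally have "poly_eval f z = 0" using \<open>t \<noteq> 0\<close> by simp
  with smooth zero \<open>z \<noteq> 0\<close> show False by (auto simp: strongly_quasi_smooth_def)
qed

section \<open>Invariant vector fields\<close>

lemma apply_field_diff: "apply_field (X - Y) f = apply_field X f - apply_field Y f"
  by (simp add: apply_field_def left_diff_distrib sum_subtractf)

lemma euler_field_component:
  "(\<Sum>j\<in>UNIV. (c j :: 'k::finite cpoly) *s coord_field j) $ k = c k"
  by (simp add: coord_field_def axis_def if_distrib[of "\<lambda>x. _ * x"] cong: if_cong)

lemma koszul_field_component:
  fixes P :: "'k::{finite,linorder} \<Rightarrow> 'k \<Rightarrow> 'k cpoly"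
  shows "(\<Sum>(j, l)\<in>{(j, l). j < l}.
       P j l *s (F j *s coord_field l - F l *s coord_field j)) $ k
     = (\<Sum>j\<in>{..<k}. P j k * F j) - (\<Sum>l\<in>{k<..}. P k l * F l)"
proof -
  let ?S = "{(j, l). j < l} :: ('k \<times> 'k) set"
  have "(\<Sum>(j, l)\<in>?S. P j l *s (F j *s coord_field l - F l *s coord_field j)) $ k
      = (\<Sum>x\<in>?S. (if snd x = k then P (fst x) k * F (fst x) else 0)
           - (if fst x = k then P k (snd x) * F (snd x) else 0))"
    by (auto simp: coord_field_def axis_def right_diff_distrib split_beta intro!: sum.cong)
  also have "\<dots> = (\<Sum>x\<in>?S. if snd x = k then P (fst x) k * F (fst x) else 0)
      - (\<Sum>x\<in>?S. if fst x = k then P k (snd x) * F (snd x) else 0)"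
    by (rule sum_subtractf)
  also have "(\<Sum>x\<in>?S. if snd x = k then P (fst x) k * F (fst x) else 0)
      = (\<Sum>x\<in>{x\<in>?S. snd x = k}. P (fst x) k * F (fst x))"
    by (rule sum.inter_filter[symmetric]) simp
  also have "\<dots> = (\<Sum>j\<in>{..<k}. P j k * F j)"
    by (rule sum.reindex_bij_witness[of _ "\<lambda>j. (j, k)" fst]) auto
  also have "(\<Sum>x\<in>?S. if fst x = k then P k (snd x) * F (snd x) else 0)
      = (\<Sum>x\<in>{x\<in>?S. fst x = k}. P k (snd x) * F (snd x))"
    by (rule sum.inter_filter[symmetric]) simp
  also have "\<dots> = (\<Sum>l\<in>{k<..}. P k l * F l)"
    by (rule sum.reindex_bij_witness[of _ "\<lambda>l. (k, l)" snd]) auto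
  finally show ?thesis .
qed

text \<open>
  The parts of degree \<open>B + A\<close> on both sides of \<open>X(f) = g f\<close> agree, so the part of degree \<open>B\<close>
  of any cofactor is again a cofactor. This gives \<open>g\<close> the degree of \<open>X\<close> without dividing by \<open>f\<close>.
\<close>

lemma cofactor_homogeneous_part:
  assumes f: "f \<in> graded_piece u (divisor_class u A)"
    and X: "\<And>j. X $ j \<in> graded_piece u (divisor_class u (B + axis j 1))"
    and g: "apply_field X f = g * f"
  shows "apply_field X f = hom_part u B g * f"
proof -
  have "X $ j * pdiff j f \<in> graded_piece u (divisor_class u (B + A))" for j
    using graded_piece_mult[OF X[of j] graded_pdiff[OF f, of j]] by simp
  then have "apply_field X f \<in> graded_piece u (divisor_class u (B + A))"
    unfolding apply_field_def by (intro graded_piece_sum)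
  then have "apply_field X f = hom_part u (B + A) (g * f)"
    using hom_part_ident g by metis
  also have "\<dots> = hom_part u B g * f" by (rule hom_part_mult[OF f])
  finally show ?thesis .
qed

text \<open>
  Each coefficient may be replaced by its part of the only degree that can contribute to the
  degree of \<open>Y k\<close>: as \<open>F j\<close> has degree \<open>A - D\<^sub>j\<close>, this is \<open>B + D\<^sub>j + D\<^sub>k - A\<close>, which is symmetric
  in \<open>j\<close> and \<open>k\<close> and so fits both equations in which the coefficient occurs.
\<close>

lemma graded_koszul_syzygies:
  fixes u :: "'k::{finite,linorder} \<Rightarrow> int ^ 'n"
  assumes f: "\<And>j. F j \<in> graded_piece u (divisor_class u (A - axis j 1))"
    and Y: "\<And>j. Y j \<in> graded_piece u (divisor_class u (B + axis j 1))"
    and zeros: "\<And>z. (\<forall>j. poly_eval (F j) z = 0) \<Longrightarrow> z = 0"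
    and syzygy: "(\<Sum>j\<in>UNIV. Y j * F j) = 0"
  shows "\<exists>P. (\<forall>j k. quasi_homogeneous u (P j k)) \<and>
    (\<forall>k. Y k = (\<Sum>j\<in>{..<k}. P j k * F j) - (\<Sum>l\<in>{k<..}. P k l * F l))"
proof -
  obtain Q where Q: "\<And>k. Y k = (\<Sum>j\<in>{..<k}. Q j k * F j) - (\<Sum>l\<in>{k<..}. Q k l * F l)"
    using syzygies_are_koszul[OF zeros syzygy] by blast
  define P where "P j k = hom_part u (B + axis j 1 + axis k 1 - A) (Q j k)" for j k
  have part: "hom_part u (B + axis k 1) (Q i l * F j) = P i l * F j"
    if "{i, l} = {j, k}" for i j k l
  proof -
    have "B + axis k 1 = (B + axis i 1 + axis l 1 - A) + (A - axis j 1)"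
      using that by (auto simp: doubleton_eq_iff)
    then show ?thesis using hom_part_mult[OF f[of j]] by (simp only: P_def)
  qed
  have "Y k = (\<Sum>j\<in>{..<k}. P j k * F j) - (\<Sum>l\<in>{k<..}. P k l * F l)" for k
  proof -
    have "Y k = hom_part u (B + axis k 1) (Y k)" using hom_part_ident[OF Y] by simp
    also have "\<dots> = (\<Sum>j\<in>{..<k}. P j k * F j) - (\<Sum>l\<in>{k<..}. P k l * F l)"
      by (subst Q) (simp add: hom_part_diff hom_part_sum part insert_commute)
    finally show ?thesis .
  qed
  then show ?thesis
    by (intro exI[of _ P]) (simp add: P_def quasi_homogeneous_hom_part)
qed

theorem theorem4p1:
  fixes \<Delta> :: "(real ^ 'n) set set"
    and \<rho> :: "'k::{finite,linorder} \<Rightarrow> (real ^ 'n) set"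
    and u :: "'k \<Rightarrow> int ^ 'n"
    and r :: nat
    and a :: "nat \<Rightarrow> (int, 'k) vec"
    and \<alpha> \<delta> :: "(int, 'k) vec set"
    and f :: "'k cpoly"
    and X :: "('k cpoly, 'k) vec"
  assumes "complete_fan \<Delta>" and "simplicial_fan \<Delta>"
    and "CARD('k) = CARD('n) + r"
    and "bij_betw \<rho> UNIV (rays \<Delta>)"
    and "\<And>j. ray_generator (\<rho> j) (u j)"
    and "independent_relations u r a"
    and "\<alpha> \<in> carrier (class_group u)"
    and "f \<in> graded_piece u \<alpha>"
    and "strongly_quasi_smooth f"
    and "\<delta> \<in> carrier (class_group u)"
    and "quasi_homogeneous_field u \<delta> X"
    and "leaves_invariant u X f"
  shows "\<exists>g. quasi_homogeneous u g \<and> apply_field X f = g * f \<and>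
    (\<forall>i\<in>{1..r}. euler_weight u (a i) \<alpha> \<noteq> 0 \<longrightarrow>
      (\<exists>P :: 'k \<Rightarrow> 'k \<Rightarrow> 'k cpoly.
        (\<forall>j k. j < k \<longrightarrow> quasi_homogeneous u (P j k)) \<and>
        X = (\<Sum>(j, k)\<in>{(j, k). j < k}.
               P j k *s (pdiff j f *s coord_field k - pdiff k f *s coord_field j)) +
            (const_poly (1 / euler_weight u (a i) \<alpha>) * g) *s
              (\<Sum>j\<in>UNIV. (of_int (a i $ j) * var_poly j) *s coord_field j)))"
proof -
  obtain A B where A: "\<alpha> = divisor_class u A" and B: "\<delta> = divisor_class u B"
    using assms(7,10) by (auto simp: carrier_class_group)
  have f: "f \<in> graded_piece u (divisor_class u A)" using assms(8) A by simp
  have X: "X $ j \<in> graded_piece u (divisor_class u (B + axis j 1))" for j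
    using assms(11) by (simp add: quasi_homogeneous_field_def deg_var_def B divisor_class_mult)
  obtain g0 where g0: "apply_field X f = g0 * f"
    using assms(12) by (auto simp: leaves_invariant_def)
  define g where "g = hom_part u B g0"
  have g: "apply_field X f = g * f"
    unfolding g_def by (rule cofactor_homogeneous_part[OF f X g0])
  have decomposition: "\<exists>P :: 'k \<Rightarrow> 'k \<Rightarrow> 'k cpoly.
        (\<forall>j k. j < k \<longrightarrow> quasi_homogeneous u (P j k)) \<and>
        X = (\<Sum>(j, k)\<in>{(j, k). j < k}.
               P j k *s (pdiff j f *s coord_field k - pdiff k f *s coord_field j)) +
            (const_poly (1 / euler_weight u (a i) \<alpha>) * g) *s
              (\<Sum>j\<in>UNIV. (of_int (a i $ j) * var_poly j) *s coord_field j)"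
    if "i \<in> {1..r}" and nz: "euler_weight u (a i) \<alpha> \<noteq> 0" for i
  proof -
    define \<theta> where "\<theta> = euler_weight u (a i) \<alpha>"
    have rel: "(\<Sum>j\<in>UNIV. a i $ j *s u j) = 0"
      using assms(6) that(1) by (simp add: independent_relations_def)
    have euler: "(\<Sum>j\<in>UNIV. of_int (a i $ j) * var_poly j * pdiff j f) = const_poly \<theta> * f"
      unfolding \<theta>_def
      by (rule euler_formula_weight[OF rel assms(7,8) strongly_quasi_smooth_nonzero[OF assms(9)]])
    \<comment> \<open>The multiple of the Euler field that has the same effect on \<open>f\<close> as \<open>X\<close>.\<close>
    define R where "R = (const_poly (1 / \<theta>) * g) *s
      (\<Sum>j\<in>UNIV. (of_int (a i $ j) * var_poly j) *s coord_field j)"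
    have R: "R $ j = const_poly (of_int (a i $ j) / \<theta>) * g * var_poly j" for j
    proof -
      have "R $ j = const_poly (1 / \<theta>) * g * (const_poly (of_int (a i $ j)) * var_poly j)"
        unfolding R_def vector_smult_component euler_field_component const_poly_of_int ..
      also have "\<dots> = const_poly (1 / \<theta> * of_int (a i $ j)) * g * var_poly j"
        by (simp only: const_poly_mult mult_ac)
      finally show ?thesis by simp
    qed
    have R_graded: "R $ j \<in> graded_piece u (divisor_class u (B + axis j 1))" for j
    proof -
      have "R $ j \<in> graded_piece u (divisor_class u (0 + B + axis j 1))"
        unfolding R g_def
        by (intro graded_piece_mult graded_const hom_part_graded graded_var)
      then show ?thesis by simp
    qed
    have "apply_field R f = const_poly (1 / \<theta>) * g
        * (\<Sum>j\<in>UNIV. of_int (a i $ j) * var_poly j * pdiff j f)"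
      unfolding apply_field_def R_def vector_smult_component euler_field_component
      by (simp add: sum_distrib_left mult.assoc)
    also have "\<dots> = const_poly (1 / \<theta> * \<theta>) * (g * f)"
      unfolding euler const_poly_mult by (simp only: mult_ac)
    finally have "apply_field R f = g * f" using nz by (simp add: \<theta>_def)
    then have "apply_field (X - R) f = 0" by (simp add: apply_field_diff g)
    then have syzygy: "(\<Sum>j\<in>UNIV. (X - R) $ j * pdiff j f) = 0"
      by (simp only: apply_field_def)
    have graded: "(X - R) $ j \<in> graded_piece u (divisor_class u (B + axis j 1))" for j
    proof -
      have "hom_part u (B + axis j 1) (X $ j - R $ j) = X $ j - R $ j"
        using hom_part_ident[OF X] hom_part_ident[OF R_graded] by (simp add: hom_part_diff)
      then show ?thesis using hom_part_graded by (metis vector_minus_component)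
    qed
    obtain P where P: "\<forall>j k. quasi_homogeneous u (P j k)"
      "\<forall>k. (X - R) $ k = (\<Sum>j\<in>{..<k}. P j k * pdiff j f) - (\<Sum>l\<in>{k<..}. P k l * pdiff l f)"
      using graded_koszul_syzygies[OF graded_pdiff[OF f] graded _ syzygy]
        common_zeros_of_partials[OF assms(9) euler] nz \<theta>_def by blast
    have "X - R = (\<Sum>(j, k)\<in>{(j, k). j < k}.
        P j k *s (pdiff j f *s coord_field k - pdiff k f *s coord_field j))"
      unfolding vec_eq_iff koszul_field_component using P(2) by blast
    then have "X = (\<Sum>(j, k)\<in>{(j, k). j < k}.
        P j k *s (pdiff j f *s coord_field k - pdiff k f *s coord_field j)) + R"
      by (simp add: algebra_simps)
    then show ?thesis
      unfolding R_def \<theta>_def using P(1) by - (rule exI[of _ P], rule conjI, simp, assumption)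
  qed
  have "quasi_homogeneous u g" by (simp add: g_def quasi_homogeneous_hom_part)
  with g decomposition show ?thesis by blast
qed

end
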